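(* \textsc{$\alpha$-Globally Optimal Assignment} admits a kernel of size $\mathcal{O}((m!)^{\ell+1})$: there is a polynomial-time algorithm that, given an instance with $m$ items and $\ell$ layers, outputs an equivalent instance of the same problem of size $\mathcal{O}((m!)^{\ell+1})$. Consequently, the problem is fixed-parameter tractable with respect to $m+\ell$.
   Context: An instance of \textsc{$\alpha$-Globally Optimal Assignment} is a tuple $(A,I,P_1,\ldots,P_\ell,\alpha)$ where $A$ is a set of $n$ agents, $I$ is a set of $m$ items, $\alpha\in\{1,\ldots,\ell\}$, and for each layer $j\in\{1,\ldots,\ell\}$ the preference profile $P_j$ assigns to every agent $a$ a preference list $<^{(j)}_a$, which is a strict linear order over a subset of $I$ (the items acceptable to $a$ in layer $j$; lists may be incomplete). A special item $b_\emptyset\notin I$ is regarded as the least preferred item of every agent. An assignment is a map $p:A\to I\cup\{b_\emptyset\}$ such that no item of $I$ is assigned to two different agents; it is legal in layer $j$ if every agent receives either $b_\emptyset$ or an item acceptable to it in layer $j$. A legal assignment $p$ is Pareto optimal in layer $j$ if there is no other legal assignment $q$ (for layer $j$) with $p(a)\le^{(j)}_a q(a)$ for all $a\in A$ and $p(a)<^{(j)}_a q(a)$ for some $a\in A$. An assignment is $\alpha$-globally optimal if there exist $\alpha$ distinct layers in each of which it is Pareto optimal. The problem asks whether an $\alpha$-globally optimal assignment exists. Fixed-parameter tractable with respect to parameter $k$ means solvable in time $f(k)\cdot|x|^{\mathcal{O}(1)}$ for a computable $f$. *)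

theory Defs
  imports Main
begin

section \<open>Assignments under multiple preference profiles\<close>

text \<open>
  Agents are the numbers below \<open>num_agents\<close>, items the numbers below \<open>num_items\<close>.
  \<open>profiles G ! j ! a\<close> is the preference list of agent \<open>a\<close> in layer \<open>j\<close>: the items acceptable
  to \<open>a\<close>, in decreasing order of preference.  Layers are numbered from 0.
\<close>

record goa =
  num_agents :: nat
  num_items :: nat
  profiles :: "nat list list list"
  threshold :: nat

definition num_layers :: "goa \<Rightarrow> nat" where
  "num_layers G = length (profiles G)"

definition pref :: "goa \<Rightarrow> nat \<Rightarrow> nat \<Rightarrow> nat list" where
  "pref G j a = profiles G ! j ! a"

definition goa_instance :: "goa \<Rightarrow> bool" where
  "goa_instance G \<longleftrightarrow>
     (\<forall>P \<in> set (profiles G). length P = num_agents G \<and>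
        (\<forall>L \<in> set P. distinct L \<and> set L \<subseteq> {..<num_items G})) \<and>
     1 \<le> threshold G \<and> threshold G \<le> num_layers G"

text \<open>
  \<open>None\<close> stands for the special item that every agent likes least; \<open>worse L x y\<close> means that
  \<open>y\<close> is strictly preferred to \<open>x\<close>.
\<close>

fun worse :: "nat list \<Rightarrow> nat option \<Rightarrow> nat option \<Rightarrow> bool" where
  "worse L x None \<longleftrightarrow> False"
| "worse L None (Some c) \<longleftrightarrow> c \<in> set L"
| "worse L (Some b) (Some c) \<longleftrightarrow> (\<exists>i k. i < k \<and> k < length L \<and> L ! i = c \<and> L ! k = b)"

definition worse_eq :: "nat list \<Rightarrow> nat option \<Rightarrow> nat option \<Rightarrow> bool" where
  "worse_eq L x y \<longleftrightarrow> x = y \<or> worse L x y"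

text \<open>Values of \<open>p\<close> at numbers that are not agents are irrelevant.\<close>

definition assignment :: "goa \<Rightarrow> (nat \<Rightarrow> nat option) \<Rightarrow> bool" where
  "assignment G p \<longleftrightarrow>
     (\<forall>a < num_agents G. \<forall>b. p a = Some b \<longrightarrow> b < num_items G) \<and>
     (\<forall>a < num_agents G. \<forall>a' < num_agents G. \<forall>b. p a = Some b \<and> p a' = Some b \<longrightarrow> a = a')"

definition legal :: "goa \<Rightarrow> nat \<Rightarrow> (nat \<Rightarrow> nat option) \<Rightarrow> bool" where
  "legal G j p \<longleftrightarrow>
     assignment G p \<and> (\<forall>a < num_agents G. \<forall>b. p a = Some b \<longrightarrow> b \<in> set (pref G j a))"

definition pareto_optimal :: "goa \<Rightarrow> nat \<Rightarrow> (nat \<Rightarrow> nat option) \<Rightarrow> bool" where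
  "pareto_optimal G j p \<longleftrightarrow>
     legal G j p \<and>
     \<not> (\<exists>q. legal G j q \<and>
            (\<forall>a < num_agents G. worse_eq (pref G j a) (p a) (q a)) \<and>
            (\<exists>a < num_agents G. worse (pref G j a) (p a) (q a)))"

definition globally_optimal :: "goa \<Rightarrow> (nat \<Rightarrow> nat option) \<Rightarrow> bool" where
  "globally_optimal G p \<longleftrightarrow>
     assignment G p \<and>
     (\<exists>S. S \<subseteq> {..<num_layers G} \<and> card S = threshold G \<and> (\<forall>j \<in> S. pareto_optimal G j p))"

definition has_globally_optimal_assignment :: "goa \<Rightarrow> bool" where
  "has_globally_optimal_assignment G \<longleftrightarrow> (\<exists>p. globally_optimal G p)"


section \<open>Model of computation\<close>

text \<open>
  First-order, call-by-value functional programs over binary trees (pure LISP with a single atom;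
  cf. N. D. Jones, Computability and Complexity from a Programming Perspective).  The running time
  is the number of evaluated subexpressions.  There is no equality test on trees, and trees are
  passed by reference, so every step inspects or allocates at most one cell; this model
  and Turing machines therefore simulate each other with polynomial overhead (for outputs whose
  size is polynomially bounded, as required of the kernels below).
\<close>

datatype sexp = Atom | Pair sexp sexp

fun left :: "sexp \<Rightarrow> sexp" where
  "left Atom = Atom"
| "left (Pair u v) = u"

fun right :: "sexp \<Rightarrow> sexp" where
  "right Atom = Atom"
| "right (Pair u v) = v"

text \<open>The number of nodes, which is also the number of bits of the preorder encoding of a tree.\<close>

fun nodes :: "sexp \<Rightarrow> nat" where
  "nodes Atom = 1"
| "nodes (Pair u v) = 1 + nodes u + nodes v"

datatype expr =
    Arg nat
  | AtomE
  | PairE expr expr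
  | LeftE expr
  | RightE expr
  | IfE expr expr expr
  | Call nat "expr list"

text \<open>
  A program is the list of the bodies of its mutually recursive functions.  \<open>Arg i\<close> is the \<open>i\<close>-th
  argument of the function being evaluated, and \<open>Atom\<close> is the only false value.  In
  \<open>eval P \<rho> e v t\<close>, \<open>\<rho>\<close> is the list of current arguments, \<open>v\<close> the value and \<open>t\<close> the time.
\<close>

type_synonym program = "expr list"

inductive eval :: "program \<Rightarrow> sexp list \<Rightarrow> expr \<Rightarrow> sexp \<Rightarrow> nat \<Rightarrow> bool"
  and evals :: "program \<Rightarrow> sexp list \<Rightarrow> expr list \<Rightarrow> sexp list \<Rightarrow> nat \<Rightarrow> bool"
  for P :: program
where
  eval_Arg: "i < length \<rho> \<Longrightarrow> eval P \<rho> (Arg i) (\<rho> ! i) 1"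
| eval_Atom: "eval P \<rho> AtomE Atom 1"
| eval_Pair: "eval P \<rho> e1 v1 t1 \<Longrightarrow> eval P \<rho> e2 v2 t2 \<Longrightarrow>
    eval P \<rho> (PairE e1 e2) (Pair v1 v2) (1 + t1 + t2)"
| eval_Left: "eval P \<rho> e v t \<Longrightarrow> eval P \<rho> (LeftE e) (left v) (1 + t)"
| eval_Right: "eval P \<rho> e v t \<Longrightarrow> eval P \<rho> (RightE e) (right v) (1 + t)"
| eval_If_true: "eval P \<rho> e0 v0 t0 \<Longrightarrow> v0 \<noteq> Atom \<Longrightarrow> eval P \<rho> e1 v t \<Longrightarrow>
    eval P \<rho> (IfE e0 e1 e2) v (1 + t0 + t)"
| eval_If_false: "eval P \<rho> e0 Atom t0 \<Longrightarrow> eval P \<rho> e2 v t \<Longrightarrow>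
    eval P \<rho> (IfE e0 e1 e2) v (1 + t0 + t)"
| eval_Call: "f < length P \<Longrightarrow> evals P \<rho> es vs ts \<Longrightarrow> eval P vs (P ! f) v t \<Longrightarrow>
    eval P \<rho> (Call f es) v (1 + ts + t)"
| evals_Nil: "evals P \<rho> [] [] 0"
| evals_Cons: "eval P \<rho> e v t \<Longrightarrow> evals P \<rho> es vs ts \<Longrightarrow>
    evals P \<rho> (e # es) (v # vs) (t + ts)"

inductive_cases eval_ArgE: "eval P \<rho> (Arg i) v t"
inductive_cases eval_AtomE: "eval P \<rho> AtomE v t"
inductive_cases eval_PairE: "eval P \<rho> (PairE e1 e2) v t"
inductive_cases eval_LeftE: "eval P \<rho> (LeftE e) v t"
inductive_cases eval_RightE: "eval P \<rho> (RightE e) v t"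
inductive_cases eval_IfE: "eval P \<rho> (IfE e0 e1 e2) v t"
inductive_cases eval_CallE: "eval P \<rho> (Call f es) v t"
inductive_cases evals_NilE: "evals P \<rho> [] vs t"
inductive_cases evals_ConsE: "evals P \<rho> (e # es) vs t"

lemma eval_deterministic:
  "eval P \<rho> e v t \<Longrightarrow> eval P \<rho> e v' t' \<Longrightarrow> v' = v \<and> t' = t"
  "evals P \<rho> es vs t \<Longrightarrow> evals P \<rho> es vs' t' \<Longrightarrow> vs' = vs \<and> t' = t"
proof (induction arbitrary: v' t' and vs' t' rule: eval_evals.inducts)
  case (eval_Arg i \<rho>)
  then show ?case by (auto elim: eval_ArgE)
next
  case (eval_Atom \<rho>)
  then show ?case by (auto elim: eval_AtomE)
next
  case (eval_Pair \<rho> e1 v1 t1 e2 v2 t2)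
  from eval_Pair.prems show ?case by (auto elim!: eval_PairE dest!: eval_Pair.IH(2,4))
next
  case (eval_Left \<rho> e v t)
  from eval_Left.prems show ?case by (auto elim!: eval_LeftE dest!: eval_Left.IH(2))
next
  case (eval_Right \<rho> e v t)
  from eval_Right.prems show ?case by (auto elim!: eval_RightE dest!: eval_Right.IH(2))
next
  case (eval_If_true \<rho> e0 v0 t0 e1 v t e2)
  from eval_If_true.prems eval_If_true.hyps show ?case
    by (auto elim!: eval_IfE dest!: eval_If_true.IH(2,4))
next
  case (eval_If_false \<rho> e0 t0 e2 v t e1)
  from eval_If_false.prems show ?case by (auto elim!: eval_IfE dest!: eval_If_false.IH(2,4))
next
  case (eval_Call f \<rho> es vs ts v t)
  from eval_Call.prems show ?case by (auto elim!: eval_CallE dest!: eval_Call.IH(3,5))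
next
  case (evals_Nil \<rho>)
  then show ?case by (auto elim: evals_NilE)
next
  case (evals_Cons \<rho> e v t es vs ts)
  from evals_Cons.prems show ?case by (auto elim!: evals_ConsE dest!: evals_Cons.IH(2,4))
qed

text \<open>The first function of a program is its main function.\<close>

definition runs :: "program \<Rightarrow> sexp \<Rightarrow> sexp \<Rightarrow> nat \<Rightarrow> bool" where
  "runs P x y t \<longleftrightarrow> P \<noteq> [] \<and> eval P [x] (P ! 0) y t"


section \<open>Encodings\<close>

fun enc_list :: "('a \<Rightarrow> sexp) \<Rightarrow> 'a list \<Rightarrow> sexp" where
  "enc_list f [] = Atom"
| "enc_list f (x # xs) = Pair (f x) (enc_list f xs)"

definition enc_nat :: "nat \<Rightarrow> sexp" where
  "enc_nat k = enc_list (\<lambda>_. Atom) (replicate k ())"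

text \<open>
  Numbers are written in unary.  The agents, items and layers of an instance have to
  be listed anyway, so this changes its size only polynomially; the size bound on kernels
  becomes more demanding than it would be for numbers in binary.
\<close>

definition encode :: "goa \<Rightarrow> sexp" where
  "encode G =
     Pair (enc_nat (num_agents G))
       (Pair (enc_nat (num_items G))
         (Pair (enc_nat (threshold G))
           (enc_list (enc_list (enc_list enc_nat)) (profiles G))))"

lemma enc_list_eq_iff:
  assumes "\<And>x y. f x = f y \<Longrightarrow> x = y"
  shows "enc_list f xs = enc_list f ys \<longleftrightarrow> xs = ys"
proof (induction xs arbitrary: ys)
  case Nil
  show ?case by (cases ys) auto
next
  case (Cons x xs)
  then show ?case by (cases ys) (auto dest: assms)
qed

lemma enc_nat_eq_iff: "enc_nat i = enc_nat k \<longleftrightarrow> i = k"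
proof (induction i arbitrary: k)
  case 0
  show ?case by (cases k) (auto simp: enc_nat_def)
next
  case (Suc i)
  then show ?case by (cases k) (auto simp: enc_nat_def)
qed

lemma encode_inject: "encode G = encode H \<longleftrightarrow> G = H"
proof
  assume eq: "encode G = encode H"
  have "num_agents G = num_agents H" "num_items G = num_items H" "threshold G = threshold H"
    using eq by (simp_all add: encode_def enc_nat_eq_iff)
  moreover have "profiles G = profiles H"
  proof -
    have *: "enc_list enc_nat xs = enc_list enc_nat ys \<longleftrightarrow> xs = ys" for xs ys
      by (rule enc_list_eq_iff) (simp add: enc_nat_eq_iff)
    have **: "enc_list (enc_list enc_nat) xs = enc_list (enc_list enc_nat) ys \<longleftrightarrow> xs = ys" for xs ys
      by (rule enc_list_eq_iff) (simp add: *)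
    have "enc_list (enc_list (enc_list enc_nat)) xs = enc_list (enc_list (enc_list enc_nat)) ys \<longleftrightarrow>
        xs = ys" for xs ys
      by (rule enc_list_eq_iff) (simp add: **)
    with eq show ?thesis by (simp add: encode_def)
  qed
  ultimately show "G = H" by simp
qed simp


section \<open>Kernels and fixed-parameter tractability\<close>

text \<open>
  A problem is given by its set \<open>inst\<close> of instances, their encoding \<open>enc\<close> and the set
  \<open>yes\<close> of positive instances.
\<close>

definition admits_kernel_of_size ::
  "('i \<Rightarrow> bool) \<Rightarrow> ('i \<Rightarrow> sexp) \<Rightarrow> ('i \<Rightarrow> bool) \<Rightarrow> ('i \<Rightarrow> nat) \<Rightarrow> bool" where
  "admits_kernel_of_size inst enc yes g \<longleftrightarrow>
     (\<exists>P c C. \<forall>x. inst x \<longrightarrow>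
        (\<exists>y t. runs P (enc x) (enc y) t \<and> t \<le> c * nodes (enc x) ^ c \<and>
               inst y \<and> (yes y \<longleftrightarrow> yes x) \<and> nodes (enc y) \<le> C * g x))"

definition computable :: "(nat \<Rightarrow> nat) \<Rightarrow> bool" where
  "computable f \<longleftrightarrow> (\<exists>P. \<forall>k. \<exists>t. runs P (enc_nat k) (enc_nat (f k)) t)"

definition fixed_parameter_tractable ::
  "('i \<Rightarrow> bool) \<Rightarrow> ('i \<Rightarrow> sexp) \<Rightarrow> ('i \<Rightarrow> bool) \<Rightarrow> ('i \<Rightarrow> nat) \<Rightarrow> bool" where
  "fixed_parameter_tractable inst enc yes \<kappa> \<longleftrightarrow>
     (\<exists>P f c. computable f \<and>
        (\<forall>x. inst x \<longrightarrow>
           (\<exists>v t. runs P (enc x) v t \<and> (v \<noteq> Atom \<longleftrightarrow> yes x) \<and>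
                  t \<le> f (\<kappa> x) * nodes (enc x) ^ c)))"

end

theory Submission
  imports Defs
begin

text \<open>
  The list of an agent matters in only two ways.  If the agent receives the item \<open>b\<close>, then only
  the part of the list down to \<open>b\<close> matters; if it receives nothing, then it can only rule out
  assignments that leave one of its acceptable items unassigned.  Call two agents \<open>b\<close>-equivalent
  if the parts of their lists down to \<open>b\<close> (whole lists, where \<open>b\<close> is unacceptable) agree in every
  layer, and keep the first \<open>m + 1\<close> agents of every \<open>b\<close>-class, for every \<open>b\<close>.  As at most \<open>m\<close> agents
  receive an item, a deleted agent that receives \<open>b\<close> can be replaced by a kept \<open>b\<close>-equivalent one
  that received nothing, and a deleted agent that accepts an unassigned item \<open>b\<close> has a kept
  \<open>b\<close>-equivalent that receives nothing and also accepts \<open>b\<close>.  So the answer does not change.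

  Counting whole lists would give about \<open>e m!\<close> possibilities per layer, and \<open>e\<^sup>\<ell>\<close> is too much for
  the claimed size.  But there are at most \<open>6 (m - 1)!\<close> lists cut off at \<open>b\<close>, so at most
  \<open>m (m + 1) (6 (m - 1)!)\<^sup>\<ell>\<close> agents are kept, and for \<open>m \<ge> 12\<close> we have \<open>12 (m - 1)! \<le> m!\<close>, which leaves
  a factor \<open>2\<^sup>\<ell>\<close> for the contribution of \<open>\<ell>\<close> to the size.  For \<open>m < 12\<close>, searching through all assignments
  takes polynomial time, and the kernel is one of two constant instances.  The same search on the
  reduced instance proves fixed-parameter tractability.
\<close>

section \<open>Time bounds for programs\<close>

text \<open>Equivalence is taken over all layers at once because a substitute must serve in every
  layer where the assignment is claimed optimal, and these layers are unknown to the reduction.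
  Lists need to agree only down to \<open>b\<close> because the outcomes at least as good as an
  acceptable \<open>b\<close> are exactly the entries down to \<open>b\<close>; an improvement after
  the exchange can then be pulled back to one before it.

  The number m + 1 also makes the substitutes distinct: after removal of the item holders from a
  class, at least as many kept candidates remain as there are deleted holders, so a greedy choice
  never gets stuck.

  The factor 6 is 2 times 3: a list cut off at \<open>b\<close> consists of other items, possibly
  followed by \<open>b\<close>, and there are at most 3 k! lists without repetition over k items.
  The threshold 12 is twice 6.

  Polynomial time refers to concrete programs, so each algorithm appears twice, as a function on
  lists and as program text, linked by evaluation with time bounds. The parameter-dependent factor
  of the search has to be computed by a program as well, which favours iterated powers of two over a
  sharper bound.\<close>

definition ev :: "program \<Rightarrow> sexp list \<Rightarrow> expr \<Rightarrow> sexp \<Rightarrow> nat \<Rightarrow> bool" where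
  "ev P \<rho> e v T \<longleftrightarrow> (\<exists>t\<le>T. eval P \<rho> e v t)"

definition evs :: "program \<Rightarrow> sexp list \<Rightarrow> expr list \<Rightarrow> sexp list \<Rightarrow> nat \<Rightarrow> bool" where
  "evs P \<rho> es vs T \<longleftrightarrow> (\<exists>t\<le>T. evals P \<rho> es vs t)"

definition fn_ev :: "program \<Rightarrow> nat \<Rightarrow> sexp list \<Rightarrow> sexp \<Rightarrow> nat \<Rightarrow> bool" where
  "fn_ev P f vs v T \<longleftrightarrow> f < length P \<and> ev P vs (P ! f) v T"

text \<open>The exact time depends on the branches taken; weakening to an upper bound lets all
  branches meet in one closed expression.\<close>

lemma ev_mono: "ev P \<rho> e v T \<Longrightarrow> v = v' \<Longrightarrow> T \<le> T' \<Longrightarrow> ev P \<rho> e v' T'"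
  unfolding ev_def by (meson le_trans)

lemma fn_ev_mono: "fn_ev P f vs v T \<Longrightarrow> v = v' \<Longrightarrow> T \<le> T' \<Longrightarrow> fn_ev P f vs v' T'"
  unfolding fn_ev_def using ev_mono by blast

text \<open>One fact per position, with the environment spelled out, so that resolution reads off
  the value without an \<open>nth\<close> goal. No function of the programs has more than six
  arguments.\<close>

lemma ev_Arg:
  "ev P (x0 # \<rho>) (Arg 0) x0 1"
  "ev P (x0 # x1 # \<rho>) (Arg (Suc 0)) x1 1"
  "ev P (x0 # x1 # x2 # \<rho>) (Arg 2) x2 1"
  "ev P (x0 # x1 # x2 # x3 # \<rho>) (Arg 3) x3 1"
  "ev P (x0 # x1 # x2 # x3 # x4 # \<rho>) (Arg 4) x4 1"
  "ev P (x0 # x1 # x2 # x3 # x4 # x5 # \<rho>) (Arg 5) x5 1"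
proof -
  have "ev P \<rho> (Arg i) (\<rho> ! i) 1" if "i < length \<rho>" for i \<rho>
    using eval_Arg[OF that] unfolding ev_def by blast
  from this[of 0 "x0 # \<rho>"] this[of 1 "x0 # x1 # \<rho>"] this[of 2 "x0 # x1 # x2 # \<rho>"]
    this[of 3 "x0 # x1 # x2 # x3 # \<rho>"] this[of 4 "x0 # x1 # x2 # x3 # x4 # \<rho>"]
    this[of 5 "x0 # x1 # x2 # x3 # x4 # x5 # \<rho>"]
  show
  "ev P (x0 # \<rho>) (Arg 0) x0 1"
  "ev P (x0 # x1 # \<rho>) (Arg (Suc 0)) x1 1"
  "ev P (x0 # x1 # x2 # \<rho>) (Arg 2) x2 1"
  "ev P (x0 # x1 # x2 # x3 # \<rho>) (Arg 3) x3 1"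
  "ev P (x0 # x1 # x2 # x3 # x4 # \<rho>) (Arg 4) x4 1"
  "ev P (x0 # x1 # x2 # x3 # x4 # x5 # \<rho>) (Arg 5) x5 1"
    by simp_all
qed

lemma ev_Atom: "ev P \<rho> AtomE Atom 1"
  unfolding ev_def by (meson eval_Atom order_refl)

lemma ev_Pair:
  "ev P \<rho> e1 v1 T1 \<Longrightarrow> ev P \<rho> e2 v2 T2 \<Longrightarrow> ev P \<rho> (PairE e1 e2) (Pair v1 v2) (1 + T1 + T2)"
  unfolding ev_def by (meson eval_Pair add_mono order_refl)

lemma ev_Left: "ev P \<rho> e v T \<Longrightarrow> left v = w \<Longrightarrow> ev P \<rho> (LeftE e) w (1 + T)"
  unfolding ev_def by (meson eval_Left add_mono order_refl)

lemma ev_Right: "ev P \<rho> e v T \<Longrightarrow> right v = w \<Longrightarrow> ev P \<rho> (RightE e) w (1 + T)"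
  unfolding ev_def by (meson eval_Right add_mono order_refl)

lemma ev_If:
  assumes "ev P \<rho> e0 v0 T0" "ev P \<rho> (if v0 = Atom then e2 else e1) v T"
  shows "ev P \<rho> (IfE e0 e1 e2) v (1 + T0 + T)"
proof -
  obtain t0 t where "t0 \<le> T0" "t \<le> T" "eval P \<rho> e0 v0 t0"
    "eval P \<rho> (if v0 = Atom then e2 else e1) v t"
    using assms unfolding ev_def by blast
  then have "eval P \<rho> (IfE e0 e1 e2) v (1 + t0 + t)"
    by (cases "v0 = Atom") (simp_all only: if_True if_False simp_thms eval_If_true eval_If_false)
  with \<open>t0 \<le> T0\<close> \<open>t \<le> T\<close> show ?thesis
    unfolding ev_def by (meson add_mono order_refl)
qed

lemma ev_Call:
  "evs P \<rho> es vs Ts \<Longrightarrow> fn_ev P f vs v T \<Longrightarrow> ev P \<rho> (Call f es) v (1 + Ts + T)"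
  unfolding ev_def evs_def fn_ev_def by (meson eval_Call add_mono order_refl)

lemma evs_Nil: "evs P \<rho> [] [] 0"
  unfolding evs_def by (meson evals_Nil order_refl)

lemma evs_Cons: "ev P \<rho> e v T \<Longrightarrow> evs P \<rho> es vs Ts \<Longrightarrow> evs P \<rho> (e # es) (v # vs) (T + Ts)"
  unfolding ev_def evs_def by (meson evals_Cons add_mono order_refl)

text \<open>
  With \<open>simp\<close>, these rules execute a body symbolically, value and time being schematic variables
  that get instantiated on the way.  \<open>ev_If\<close> leaves a conditional expression for \<open>simp\<close> to resolve.
\<close>

lemmas ev_intros = ev_Arg ev_Atom ev_Pair ev_Left ev_Right ev_If ev_Call evs_Nil evs_Cons

section \<open>Codes of truth values, lists and optional items\<close>

abbreviation ttE :: expr where "ttE \<equiv> PairE AtomE AtomE"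
definition sbool :: "bool \<Rightarrow> sexp" where "sbool b = (if b then Pair Atom Atom else Atom)"

lemma sbool_simps [simp]:
  "sbool True = Pair Atom Atom" "sbool False = Atom" "sbool b = Atom \<longleftrightarrow> \<not> b"
  by (auto simp: sbool_def)

lemma Atom_eq_sbool_iff [simp]: "Atom = sbool b \<longleftrightarrow> \<not> b"
  by (auto simp: sbool_def)

lemma nodes_enc_nat [simp]: "nodes (enc_nat k) = 2 * k + 1"
  by (induction k) (auto simp: enc_nat_def)

lemma enc_nat_simps [simp]: "enc_nat 0 = Atom" "enc_nat (Suc k) = Pair Atom (enc_nat k)"
  by (simp_all add: enc_nat_def)

abbreviation enc_nats :: "nat list \<Rightarrow> sexp" where "enc_nats \<equiv> enc_list enc_nat"
abbreviation enc_layer :: "nat list list \<Rightarrow> sexp" where "enc_layer \<equiv> enc_list enc_nats"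
abbreviation enc_layers :: "nat list list list \<Rightarrow> sexp" where "enc_layers \<equiv> enc_list enc_layer"

lemma enc_nats_eq_iff: "enc_nats xs = enc_nats ys \<longleftrightarrow> xs = ys"
  by (rule enc_list_eq_iff) (simp add: enc_nat_eq_iff)

lemma enc_layer_eq_iff: "enc_layer xs = enc_layer ys \<longleftrightarrow> xs = ys"
  by (rule enc_list_eq_iff) (simp add: enc_nats_eq_iff)

text \<open>In the code of a number every left child is \<open>Atom\<close>, so a nonatomic left
  child can mark \<open>None\<close>.\<close>

fun enc_opt :: "nat option \<Rightarrow> sexp" where
  "enc_opt None = Pair (Pair Atom Atom) Atom"
| "enc_opt (Some b) = enc_nat b"

lemma enc_opt_Some_neq [simp]:
  "enc_nat b \<noteq> Pair (Pair Atom Atom) Atom" "Pair (Pair Atom Atom) Atom \<noteq> enc_nat b"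
  by (cases b; simp)+

lemma enc_opt_eq_iff: "enc_opt x = enc_opt y \<longleftrightarrow> x = y"
  by (cases x; cases y) (auto simp: enc_nat_eq_iff)

lemma enc_nat_eq_opt_iff: "enc_nat c = enc_opt y \<longleftrightarrow> y = Some c"
  using enc_opt_eq_iff[of "Some c" y] by auto

lemma enc_none_eq_opt_iff: "Pair (Pair Atom Atom) Atom = enc_opt y \<longleftrightarrow> y = None"
  using enc_opt_eq_iff[of None y] by auto

lemmas enc_eq_iffs = enc_nat_eq_iff enc_nats_eq_iff enc_layer_eq_iff enc_opt_eq_iff
  enc_nat_eq_opt_iff enc_none_eq_opt_iff

section \<open>Exhaustive search and reduction\<close>

text \<open>
  A list \<open>h\<close> of length \<open>m\<close> over \<open>{..n}\<close> represents the assignment that gives item \<open>b\<close> to agent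
  \<open>h ! b\<close>, where \<open>n\<close> stands for nobody and only the first item of an agent counts, so that every
  such list is an assignment.  Agent \<open>a\<close> receives \<open>find_item h a 0\<close>.
\<close>

fun find_item :: "nat list \<Rightarrow> nat \<Rightarrow> nat \<Rightarrow> nat option" where
  "find_item [] a b = None"
| "find_item (x # h) a b = (if x = a then Some b else find_item h a (Suc b))"

text \<open>
  If \<open>x\<close> is \<open>None\<close> or in \<open>L\<close>, this tests in one pass that \<open>y\<close> is \<open>None\<close> or in \<open>L\<close>, and not worse
  than \<open>x\<close>.  With \<open>x = None\<close> it tests legality.
\<close>

fun scan :: "nat list \<Rightarrow> nat option \<Rightarrow> nat option \<Rightarrow> bool" where
  "scan [] x y \<longleftrightarrow> y = None"
| "scan (c # L) x y \<longleftrightarrow> y = Some c \<or> x \<noteq> Some c \<and> scan L x y"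

fun dominated :: "nat list list \<Rightarrow> nat \<Rightarrow> nat list \<Rightarrow> nat list \<Rightarrow> bool" where
  "dominated [] a h g \<longleftrightarrow> True"
| "dominated (L # P) a h g \<longleftrightarrow>
     scan L (find_item h a 0) (find_item g a 0) \<and> dominated P (Suc a) h g"

text \<open>Entries are prepended, so the recursion fixes the list from its last entry to its first.
  The value \<open>n\<close> is included because it stands for nobody.\<close>

fun search :: "(nat list \<Rightarrow> bool) \<Rightarrow> nat \<Rightarrow> nat \<Rightarrow> nat list \<Rightarrow> bool" where
  "search Q n 0 g \<longleftrightarrow> Q g"
| "search Q n (Suc k) g \<longleftrightarrow> (\<exists>v\<le>n. search Q n k (v # g))"

text \<open>Once no agent is worse off, a strict gain somewhere is the same as a difference
  somewhere.\<close>

definition improves :: "nat \<Rightarrow> nat list list \<Rightarrow> nat list \<Rightarrow> nat list \<Rightarrow> bool" where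
  "improves n P h g \<longleftrightarrow> dominated P 0 h g \<and> (\<exists>a<n. find_item h a 0 \<noteq> find_item g a 0)"

text \<open>The list \<open>[]\<close> gives nothing to anybody, so being dominated by
  \<open>h\<close> turns into legality of \<open>h\<close>.\<close>

definition po_list :: "nat \<Rightarrow> nat \<Rightarrow> nat list list \<Rightarrow> nat list \<Rightarrow> bool" where
  "po_list n m P h \<longleftrightarrow> dominated P 0 [] h \<and> \<not> search (improves n P h) n m []"

definition solve :: "goa \<Rightarrow> bool" where
  "solve G \<longleftrightarrow> search (\<lambda>h. threshold G \<le>
     length (filter (\<lambda>P. po_list (num_agents G) (num_items G) P h) (profiles G)))
     (num_agents G) (num_items G) []"

text \<open>The cut comes after \<open>b\<close>, so the result still shows whether \<open>b\<close>
  is acceptable.\<close>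

fun up :: "nat \<Rightarrow> nat list \<Rightarrow> nat list" where
  "up b [] = []"
| "up b (x # xs) = x # (if x = b then [] else up b xs)"

definition sig :: "nat list list list \<Rightarrow> nat \<Rightarrow> nat \<Rightarrow> nat list list" where
  "sig Ps a b = map (\<lambda>P. up b (P ! a)) Ps"

text \<open>At most \<open>m\<close> earlier members, not fewer than \<open>m\<close>: this keeps
  the first m + 1 agents of a class.\<close>

definition few_before :: "nat list list list \<Rightarrow> nat \<Rightarrow> nat \<Rightarrow> nat \<Rightarrow> bool" where
  "few_before Ps m a b \<longleftrightarrow> card {i. i < a \<and> sig Ps i b = sig Ps a b} \<le> m"

definition kept :: "nat list list list \<Rightarrow> nat \<Rightarrow> nat \<Rightarrow> bool" where
  "kept Ps m a \<longleftrightarrow> (\<exists>b<m. few_before Ps m a b)"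

fun select_from :: "(nat \<Rightarrow> bool) \<Rightarrow> 'a list \<Rightarrow> nat \<Rightarrow> 'a list" where
  "select_from K [] a = []"
| "select_from K (x # xs) a =
     (if K a then x # select_from K xs (Suc a) else select_from K xs (Suc a))"

definition reduce :: "goa \<Rightarrow> goa" where
  "reduce G = \<lparr>num_agents = card {a. a < num_agents G \<and> kept (profiles G) (num_items G) a},
     num_items = num_items G,
     profiles = map (\<lambda>P. select_from (kept (profiles G) (num_items G)) P 0) (profiles G),
     threshold = threshold G\<rparr>"

section \<open>The program\<close>

abbreviation noneE :: expr where "noneE \<equiv> PairE ttE AtomE"
abbreviation "X0 \<equiv> Arg 0"
abbreviation "X1 \<equiv> Arg (Suc 0)"
abbreviation "X2 \<equiv> Arg 2"
abbreviation "X3 \<equiv> Arg 3"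
abbreviation "X4 \<equiv> Arg 4"
abbreviation "X5 \<equiv> Arg 5"
abbreviation nE :: "expr \<Rightarrow> expr" where "nE e \<equiv> LeftE e"
abbreviation mE :: "expr \<Rightarrow> expr" where "mE e \<equiv> LeftE (RightE e)"
abbreviation tE :: "expr \<Rightarrow> expr" where "tE e \<equiv> LeftE (RightE (RightE e))"
abbreviation pE :: "expr \<Rightarrow> expr" where "pE e \<equiv> RightE (RightE (RightE e))"

text \<open>The numbers are positions in \<open>prog\<close>; position 0 is left to the main
  function. As opaque constants they keep calls symbolic during evaluation.\<close>

definition equal_fn :: nat where "equal_fn = 1"
definition find_fn :: nat where "find_fn = 2"
definition scan_fn :: nat where "scan_fn = 3"
definition dominated_fn :: nat where "dominated_fn = 4"
definition differ_fn :: nat where "differ_fn = 5"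
definition improve_fn :: nat where "improve_fn = 6"
definition count_fn :: nat where "count_fn = 7"
definition search_fn :: nat where "search_fn = 8"
definition solve_fn :: nat where "solve_fn = 9"
definition up_fn :: nat where "up_fn = 10"
definition nth_fn :: nat where "nth_fn = 11"
definition sig_fn :: nat where "sig_fn = 12"
definition few_fn :: nat where "few_fn = 13"
definition kept_fn :: nat where "kept_fn = 14"
definition select_fn :: nat where "select_fn = 15"
definition select_all_fn :: nat where "select_all_fn = 16"
definition num_kept_fn :: nat where "num_kept_fn = 17"
definition reduce_fn :: nat where "reduce_fn = 18"

definition equal_body :: expr where
  "equal_body = IfE X0
    (IfE X1
      (IfE (Call equal_fn [LeftE X0, LeftE X1]) (Call equal_fn [RightE X0, RightE X1]) AtomE)
      AtomE)
    (IfE X1 AtomE ttE)"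

definition find_body :: expr where
  "find_body = IfE X0
    (IfE (Call equal_fn [LeftE X0, X1]) X2 (Call find_fn [RightE X0, X1, PairE AtomE X2]))
    noneE"

definition scan_body :: expr where
  "scan_body = IfE X0
    (IfE (Call equal_fn [LeftE X0, X2]) ttE
      (IfE (Call equal_fn [LeftE X0, X1]) AtomE (Call scan_fn [RightE X0, X1, X2])))
    (Call equal_fn [noneE, X2])"

definition dominated_body :: expr where
  "dominated_body = IfE X0
    (IfE (Call scan_fn [LeftE X0, Call find_fn [X2, X1, AtomE], Call find_fn [X3, X1, AtomE]])
      (Call dominated_fn [RightE X0, PairE AtomE X1, X2, X3]) AtomE)
    ttE"

definition differ_body :: expr where
  "differ_body = IfE X0
    (IfE (Call equal_fn [Call find_fn [X1, RightE X0, AtomE], Call find_fn [X2, RightE X0, AtomE]])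
      (Call differ_fn [RightE X0, X1, X2]) ttE)
    AtomE"

text \<open>
  \<open>improve_fn\<close> and \<open>search_fn\<close> extend the list in their third argument by as many entries as the
  first argument says; the second one runs from \<open>n\<close> down to 0 through the values of the next entry.
\<close>

definition improve_body :: expr where
  "improve_body = IfE X0
    (IfE (Call improve_fn [RightE X0, X3, PairE X1 X2, X3, X4, X5]) ttE
      (IfE X1 (Call improve_fn [X0, RightE X1, X2, X3, X4, X5]) AtomE))
    (IfE (Call dominated_fn [X4, AtomE, X5, X2]) (Call differ_fn [X3, X5, X2]) AtomE)"

text \<open>The second argument counts down the optimal layers still to be found; reaching zero
  means success.\<close>

definition count_body :: expr where
  "count_body = IfE X1
    (IfE X0
      (IfE (Call dominated_fn [LeftE X0, AtomE, AtomE, X2])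
        (IfE (Call improve_fn [X4, X3, AtomE, X3, LeftE X0, X2])
          (Call count_fn [RightE X0, X1, X2, X3, X4])
          (Call count_fn [RightE X0, RightE X1, X2, X3, X4]))
        (Call count_fn [RightE X0, X1, X2, X3, X4]))
      AtomE)
    ttE"

definition search_body :: expr where
  "search_body = IfE X0
    (IfE (Call search_fn [RightE X0, nE X3, PairE X1 X2, X3]) ttE
      (IfE X1 (Call search_fn [X0, RightE X1, X2, X3]) AtomE))
    (Call count_fn [pE X3, tE X3, X2, nE X3, mE X3])"

definition solve_body :: expr where
  "solve_body = Call search_fn [mE X0, nE X0, AtomE, X0]"

definition up_body :: expr where
  "up_body = IfE X1
    (PairE (LeftE X1) (IfE (Call equal_fn [LeftE X1, X0]) AtomE (Call up_fn [X0, RightE X1])))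
    AtomE"

definition nth_body :: expr where
  "nth_body = IfE X1 (Call nth_fn [RightE X0, RightE X1]) (LeftE X0)"

definition sig_body :: expr where
  "sig_body = IfE X0
    (PairE (Call up_fn [X2, Call nth_fn [LeftE X0, X1]]) (Call sig_fn [RightE X0, X1, X2]))
    AtomE"

text \<open>The first argument is a budget that each match reduces by one; a match on an empty
  budget is a failure. In this way a cardinality is compared with a bound without being
  computed.\<close>

definition few_body :: expr where
  "few_body = IfE X1
    (IfE (Call equal_fn [Call sig_fn [X4, RightE X1, X3], X2])
      (IfE X0 (Call few_fn [RightE X0, RightE X1, X2, X3, X4]) AtomE)
      (Call few_fn [X0, RightE X1, X2, X3, X4]))
    ttE"

definition kept_body :: expr where
  "kept_body = IfE X1
    (IfE (Call few_fn [X2, X0, Call sig_fn [X3, X0, RightE X1], RightE X1, X3]) ttE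
      (Call kept_fn [X0, RightE X1, X2, X3]))
    AtomE"

definition select_body :: expr where
  "select_body = IfE X0
    (IfE (Call kept_fn [X1, X2, X2, X3])
      (PairE (LeftE X0) (Call select_fn [RightE X0, PairE AtomE X1, X2, X3]))
      (Call select_fn [RightE X0, PairE AtomE X1, X2, X3]))
    AtomE"

definition select_all_body :: expr where
  "select_all_body = IfE X0
    (PairE (Call select_fn [LeftE X0, AtomE, X1, X2]) (Call select_all_fn [RightE X0, X1, X2]))
    AtomE"

definition num_kept_body :: expr where
  "num_kept_body = IfE X0
    (IfE (Call kept_fn [RightE X0, X1, X1, X2])
      (PairE AtomE (Call num_kept_fn [RightE X0, X1, X2]))
      (Call num_kept_fn [RightE X0, X1, X2]))
    AtomE"

definition reduce_body :: expr where
  "reduce_body = PairE (Call num_kept_fn [nE X0, mE X0, pE X0])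
    (PairE (mE X0) (PairE (tE X0) (Call select_all_fn [pE X0, mE X0, pE X0])))"

text \<open>The kernelization and the decision procedure differ only in their main function \<open>e0\<close>.\<close>

definition prog :: "expr \<Rightarrow> program" where
  "prog e0 =
    [e0, equal_body, find_body, scan_body, dominated_body, differ_body, improve_body, count_body,
     search_body, solve_body, up_body, nth_body, sig_body, few_body, kept_body, select_body,
     select_all_body, num_kept_body, reduce_body]"

text \<open>This rule and its analogues reduce a call to the body and leave two side goals, so a
  symbolic run may end with any value and bound, to be compared with the intended ones
  afterwards.\<close>

lemma equal_fnI:
  "ev (prog e0) vs equal_body v T \<Longrightarrow> v = v' \<Longrightarrow> T \<le> T' \<Longrightarrow>
    fn_ev (prog e0) equal_fn vs v' T'"
  by (rule fn_ev_mono) (simp_all add: fn_ev_def prog_def equal_fn_def)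

lemma find_fnI:
  "ev (prog e0) vs find_body v T \<Longrightarrow> v = v' \<Longrightarrow> T \<le> T' \<Longrightarrow>
    fn_ev (prog e0) find_fn vs v' T'"
  by (rule fn_ev_mono) (simp_all add: fn_ev_def prog_def find_fn_def)

lemma scan_fnI:
  "ev (prog e0) vs scan_body v T \<Longrightarrow> v = v' \<Longrightarrow> T \<le> T' \<Longrightarrow>
    fn_ev (prog e0) scan_fn vs v' T'"
  by (rule fn_ev_mono) (simp_all add: fn_ev_def prog_def scan_fn_def)

lemma dominated_fnI:
  "ev (prog e0) vs dominated_body v T \<Longrightarrow> v = v' \<Longrightarrow> T \<le> T' \<Longrightarrow>
    fn_ev (prog e0) dominated_fn vs v' T'"
  by (rule fn_ev_mono) (simp_all add: fn_ev_def prog_def dominated_fn_def)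

lemma differ_fnI:
  "ev (prog e0) vs differ_body v T \<Longrightarrow> v = v' \<Longrightarrow> T \<le> T' \<Longrightarrow>
    fn_ev (prog e0) differ_fn vs v' T'"
  by (rule fn_ev_mono) (simp_all add: fn_ev_def prog_def differ_fn_def)

lemma improve_fnI:
  "ev (prog e0) vs improve_body v T \<Longrightarrow> v = v' \<Longrightarrow> T \<le> T' \<Longrightarrow>
    fn_ev (prog e0) improve_fn vs v' T'"
  by (rule fn_ev_mono) (simp_all add: fn_ev_def prog_def improve_fn_def)

lemma count_fnI:
  "ev (prog e0) vs count_body v T \<Longrightarrow> v = v' \<Longrightarrow> T \<le> T' \<Longrightarrow>
    fn_ev (prog e0) count_fn vs v' T'"
  by (rule fn_ev_mono) (simp_all add: fn_ev_def prog_def count_fn_def)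

lemma search_fnI:
  "ev (prog e0) vs search_body v T \<Longrightarrow> v = v' \<Longrightarrow> T \<le> T' \<Longrightarrow>
    fn_ev (prog e0) search_fn vs v' T'"
  by (rule fn_ev_mono) (simp_all add: fn_ev_def prog_def search_fn_def)

lemma solve_fnI:
  "ev (prog e0) vs solve_body v T \<Longrightarrow> v = v' \<Longrightarrow> T \<le> T' \<Longrightarrow>
    fn_ev (prog e0) solve_fn vs v' T'"
  by (rule fn_ev_mono) (simp_all add: fn_ev_def prog_def solve_fn_def)

lemma up_fnI:
  "ev (prog e0) vs up_body v T \<Longrightarrow> v = v' \<Longrightarrow> T \<le> T' \<Longrightarrow>
    fn_ev (prog e0) up_fn vs v' T'"
  by (rule fn_ev_mono) (simp_all add: fn_ev_def prog_def up_fn_def)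

lemma nth_fnI:
  "ev (prog e0) vs nth_body v T \<Longrightarrow> v = v' \<Longrightarrow> T \<le> T' \<Longrightarrow>
    fn_ev (prog e0) nth_fn vs v' T'"
  by (rule fn_ev_mono) (simp_all add: fn_ev_def prog_def nth_fn_def)

lemma sig_fnI:
  "ev (prog e0) vs sig_body v T \<Longrightarrow> v = v' \<Longrightarrow> T \<le> T' \<Longrightarrow>
    fn_ev (prog e0) sig_fn vs v' T'"
  by (rule fn_ev_mono) (simp_all add: fn_ev_def prog_def sig_fn_def)

lemma few_fnI:
  "ev (prog e0) vs few_body v T \<Longrightarrow> v = v' \<Longrightarrow> T \<le> T' \<Longrightarrow>
    fn_ev (prog e0) few_fn vs v' T'"
  by (rule fn_ev_mono) (simp_all add: fn_ev_def prog_def few_fn_def)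

lemma kept_fnI:
  "ev (prog e0) vs kept_body v T \<Longrightarrow> v = v' \<Longrightarrow> T \<le> T' \<Longrightarrow>
    fn_ev (prog e0) kept_fn vs v' T'"
  by (rule fn_ev_mono) (simp_all add: fn_ev_def prog_def kept_fn_def)

lemma select_fnI:
  "ev (prog e0) vs select_body v T \<Longrightarrow> v = v' \<Longrightarrow> T \<le> T' \<Longrightarrow>
    fn_ev (prog e0) select_fn vs v' T'"
  by (rule fn_ev_mono) (simp_all add: fn_ev_def prog_def select_fn_def)

lemma select_all_fnI:
  "ev (prog e0) vs select_all_body v T \<Longrightarrow> v = v' \<Longrightarrow> T \<le> T' \<Longrightarrow>
    fn_ev (prog e0) select_all_fn vs v' T'"
  by (rule fn_ev_mono) (simp_all add: fn_ev_def prog_def select_all_fn_def)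

lemma num_kept_fnI:
  "ev (prog e0) vs num_kept_body v T \<Longrightarrow> v = v' \<Longrightarrow> T \<le> T' \<Longrightarrow>
    fn_ev (prog e0) num_kept_fn vs v' T'"
  by (rule fn_ev_mono) (simp_all add: fn_ev_def prog_def num_kept_fn_def)

lemma reduce_fnI:
  "ev (prog e0) vs reduce_body v T \<Longrightarrow> v = v' \<Longrightarrow> T \<le> T' \<Longrightarrow>
    fn_ev (prog e0) reduce_fn vs v' T'"
  by (rule fn_ev_mono) (simp_all add: fn_ev_def prog_def reduce_fn_def)

text \<open>
  In the time bounds, \<open>N\<close> is an upper bound for the numbers of agents, items and layers.
\<close>

fun search_time :: "nat \<Rightarrow> nat \<Rightarrow> nat \<Rightarrow> nat" where
  "search_time K n 0 = K"
| "search_time K n (Suc k) = (n + 1) * (K + search_time K n k)"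

text \<open>The constants here and below are rounded-up step counts of the bodies, multiplied by the
  number of recursive calls.\<close>

definition find_time :: "nat \<Rightarrow> nat" where "find_time N = (N + 1) * (30 * N + 100)"
definition scan_time :: "nat \<Rightarrow> nat" where "scan_time N = (N + 1) * (60 * N + 300)"
definition dominated_time :: "nat \<Rightarrow> nat" where
  "dominated_time N = (N + 1) * (scan_time N + 2 * find_time N + 60)"
definition differ_time :: "nat \<Rightarrow> nat" where
  "differ_time N = (N + 1) * (2 * find_time N + 30 * N + 115)"
definition leaf_time :: "nat \<Rightarrow> nat" where "leaf_time N = dominated_time N + differ_time N + 60"
definition count_time :: "nat \<Rightarrow> nat \<Rightarrow> nat \<Rightarrow> nat" where
  "count_time N n m = (N + 1) * (dominated_time N + search_time (leaf_time N) n m + 60)"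
definition solve_time :: "nat \<Rightarrow> nat \<Rightarrow> nat \<Rightarrow> nat" where
  "solve_time N n m = search_time (count_time N n m + 60) n m + 20"

definition up_time :: "nat \<Rightarrow> nat" where "up_time N = (N + 1) * (30 * N + 100)"
definition sig_time :: "nat \<Rightarrow> nat" where "sig_time N = (N + 1) * (up_time N + 20 * N + 60)"
definition sig_equal_time :: "nat \<Rightarrow> nat" where
  "sig_equal_time N = 15 * (1 + N * (2 + N * (2 * N + 2)))"
definition few_time :: "nat \<Rightarrow> nat" where
  "few_time N = (N + 1) * (sig_time N + sig_equal_time N + 60)"
definition kept_time :: "nat \<Rightarrow> nat" where "kept_time N = (N + 1) * (few_time N + sig_time N + 60)"
definition select_time :: "nat \<Rightarrow> nat" where "select_time N = (N + 1) * (kept_time N + 60)"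
definition select_all_time :: "nat \<Rightarrow> nat" where "select_all_time N = (N + 1) * (select_time N + 40)"
definition num_kept_time :: "nat \<Rightarrow> nat" where "num_kept_time N = (N + 1) * (kept_time N + 60)"
definition reduce_time :: "nat \<Rightarrow> nat" where "reduce_time N = num_kept_time N + select_all_time N + 60"

lemma find_item_SomeD: "find_item h a b = Some c \<Longrightarrow> b \<le> c \<and> c < b + length h"
  by (induction h arbitrary: b) (fastforce split: if_splits)+

text \<open>Entries are bounded as well as the length, since comparing unary numbers takes time
  proportional to their values.\<close>

definition ok_list :: "nat \<Rightarrow> nat list \<Rightarrow> bool" where
  "ok_list N h \<longleftrightarrow> set h \<subseteq> {..N} \<and> length h \<le> N"

definition ok_layers :: "nat \<Rightarrow> nat \<Rightarrow> nat list list list \<Rightarrow> bool" where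
  "ok_layers N n Ps \<longleftrightarrow> length Ps \<le> N \<and> n \<le> N \<and>
     (\<forall>P\<in>set Ps. length P = n \<and> (\<forall>L\<in>set P. ok_list N L))"

lemma nodes_enc_list_le:
  "\<forall>x\<in>set xs. nodes (f x) \<le> k \<Longrightarrow> nodes (enc_list f xs) \<le> 1 + length xs * (k + 1)"
  by (induction xs) auto

lemma set_up_subset: "set (up b L) \<subseteq> set L"
  by (induction L) auto

lemma length_up_le: "length (up b L) \<le> length L"
  by (induction L) auto

lemma ok_list_nodes_le:
  assumes "ok_list N L"
  shows "nodes (enc_nats L) \<le> 1 + N * (2 * N + 2)"
proof -
  have "nodes (enc_nats L) \<le> 1 + length L * (2 * N + 1 + 1)"
    by (rule nodes_enc_list_le) (use assms in \<open>auto simp: ok_list_def\<close>)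
  also have "\<dots> \<le> 1 + N * (2 * N + 1 + 1)"
    by (intro add_mono mult_le_mono) (use assms in \<open>auto simp: ok_list_def\<close>)
  finally show ?thesis by simp
qed

text \<open>The comparison of two trees is linear in the first one, so this size bound determines
  the cost of comparing signatures.\<close>

lemma nodes_sig_le:
  assumes "ok_layers N n Ps" "a < n"
  shows "nodes (enc_layer (sig Ps a b)) \<le> 1 + N * (2 + N * (2 * N + 2))"
proof -
  have "nodes (enc_nats (up b (P ! a))) \<le> 1 + N * (2 * N + 2)" if "P \<in> set Ps" for P
  proof (rule ok_list_nodes_le)
    have "ok_list N (P ! a)" using that assms by (auto simp: ok_layers_def)
    then show "ok_list N (up b (P ! a))"
      using set_up_subset[of b "P ! a"] length_up_le[of b "P ! a"] by (auto simp: ok_list_def)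
  qed
  then have "\<forall>L\<in>set (sig Ps a b). nodes (enc_nats L) \<le> 1 + N * (2 * N + 2)"
    unfolding sig_def set_map by blast
  from nodes_enc_list_le[OF this]
  have "nodes (enc_layer (sig Ps a b)) \<le> 1 + length (sig Ps a b) * (1 + N * (2 * N + 2) + 1)" .
  also have "\<dots> \<le> 1 + N * (1 + N * (2 * N + 2) + 1)"
    using assms(1) by (intro add_mono mult_le_mono) (auto simp: sig_def ok_layers_def)
  finally show ?thesis by simp
qed

lemma encode_sel [simp]:
  "left (encode G) = enc_nat (num_agents G)"
  "left (right (encode G)) = enc_nat (num_items G)"
  "left (right (right (encode G))) = enc_nat (threshold G)"
  "right (right (right (encode G))) = enc_layers (profiles G)"
  by (simp_all add: encode_def)

section \<open>Values and running times of the program's functions\<close>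

context fixes e0 :: expr and N :: nat begin

abbreviation "call \<equiv> fn_ev (prog e0)"

text \<open>The recursion never goes deeper than the first tree, so its size alone bounds the
  time.\<close>

lemma call_equal: "call equal_fn [u, v] (sbool (u = v)) (15 * nodes u)"
proof (induction u arbitrary: v)
  case Atom
  show ?case
  proof (cases v)
    case Atom
    then show ?thesis
      by - (rule equal_fnI[unfolded equal_body_def], (rule ev_intros | simp)+)
  next
    case (Pair v1 v2)
    then show ?thesis
      by - (rule equal_fnI[unfolded equal_body_def], (rule ev_intros | simp)+)
  qed
next
  case (Pair u1 u2)
  show ?case
  proof (cases v)
    case Atom
    then show ?thesis
      by - (rule equal_fnI[unfolded equal_body_def], (rule ev_intros | simp)+)
  next
    case v: (Pair v1 v2)
    show ?thesis
    proof (cases "v1 = u1")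
      case True
      with v show ?thesis
        by - (rule equal_fnI[unfolded equal_body_def], (rule ev_intros Pair.IH | simp)+)
    next
      case False
      with v have "u1 \<noteq> v1" by simp
      with v show ?thesis
        by - (rule equal_fnI[unfolded equal_body_def], (rule ev_intros Pair.IH | simp)+)
    qed
  qed
qed

text \<open>The summand 75 is 15 times the five nodes of the code of \<open>None\<close>, so that
  all comparisons of optional items share one bound.\<close>

lemma call_equal_nat:
  "c \<le> N \<Longrightarrow> call equal_fn [enc_nat c, v] (sbool (enc_nat c = v)) (30 * N + 75)"
  by (rule fn_ev_mono[OF call_equal]) simp_all

lemma call_equal_opt:
  "(case x of None \<Rightarrow> True | Some c \<Rightarrow> c \<le> N) \<Longrightarrow>
    call equal_fn [enc_opt x, v] (sbool (enc_opt x = v)) (30 * N + 75)"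
  by (cases x) (auto intro!: fn_ev_mono[OF call_equal])

lemma call_equal_none:
  "call equal_fn [Pair (Pair Atom Atom) Atom, v] (sbool (Pair (Pair Atom Atom) Atom = v)) (30 * N + 75)"
  using call_equal_opt[of None v] by simp

lemma call_find_aux:
  assumes "set h \<subseteq> {..N}"
  shows "call find_fn [enc_nats h, enc_nat a, enc_nat b] (enc_opt (find_item h a b))
    ((length h + 1) * (30 * N + 100))"
  using assms
proof (induction h arbitrary: b)
  case Nil
  show ?case
    \<comment> \<open>The three goals are the symbolic run of the body, the equality of the values
      and the arithmetic of the bound; most evaluations below follow this scheme.\<close>
    by - (rule find_fnI[unfolded find_body_def],
        ((rule ev_intros | simp add: enc_eq_iffs)+)[1],
        simp add: enc_eq_iffs, simp add: algebra_simps)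
next
  case (Cons x h)
  from Cons.prems have x: "x \<le> N" and h: "set h \<subseteq> {..N}" by auto
  note IH = Cons.IH[OF h, of "Suc b", simplified]
  show ?case
  proof (cases "x = a")
    case True
    with x show ?thesis
      by - (rule find_fnI[unfolded find_body_def],
        ((rule ev_intros call_equal_nat | simp add: enc_eq_iffs)+)[1],
        simp add: enc_eq_iffs, simp add: algebra_simps)
  next
    case False
    with x show ?thesis
      by - (rule find_fnI[unfolded find_body_def],
        ((rule ev_intros call_equal_nat IH | simp add: enc_eq_iffs)+)[1],
        simp add: enc_eq_iffs, simp add: algebra_simps)
  qed
qed

lemma call_find:
  assumes "ok_list N h"
  shows "call find_fn [enc_nats h, enc_nat a, Atom] (enc_opt (find_item h a 0)) (find_time N)"
proof -
  have "call find_fn [enc_nats h, enc_nat a, enc_nat 0] (enc_opt (find_item h a 0))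
    ((length h + 1) * (30 * N + 100))"
    by (rule call_find_aux) (use assms in \<open>auto simp: ok_list_def\<close>)
  then show ?thesis
    \<comment> \<open>The code of the start item 0 is \<open>Atom\<close>, the form in which it
      occurs in the bodies.\<close>
    by (rule fn_ev_mono[THEN subst[of _ _ "\<lambda>x. call find_fn [_, _, x] _ _", OF enc_nat_simps(1)]])
      (use assms in \<open>auto simp: ok_list_def find_time_def intro!: mult_le_mono\<close>)
qed

lemma call_scan_aux:
  assumes "set L \<subseteq> {..N}"
  shows "call scan_fn [enc_nats L, enc_opt x, enc_opt y] (sbool (scan L x y))
    ((length L + 1) * (60 * N + 300))"
  using assms
proof (induction L)
  case Nil
  show ?case
    by - (rule scan_fnI[unfolded scan_body_def],
        ((rule ev_intros call_equal_none | simp add: enc_eq_iffs)+)[1],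
        simp add: enc_eq_iffs, simp add: algebra_simps)
next
  case (Cons c L)
  from Cons.prems have c: "c \<le> N" and h: "set L \<subseteq> {..N}" by auto
  note IH = Cons.IH[OF h]
  consider "y = Some c" | "y \<noteq> Some c" "x = Some c" | "y \<noteq> Some c" "x \<noteq> Some c" by blast
  then show ?case
  proof cases
    case 1
    with c show ?thesis
      by - (rule scan_fnI[unfolded scan_body_def],
        ((rule ev_intros call_equal_nat | simp add: enc_eq_iffs)+)[1],
        simp add: enc_eq_iffs, simp add: algebra_simps)
  next
    case 2
    with c show ?thesis
      by - (rule scan_fnI[unfolded scan_body_def],
        ((rule ev_intros call_equal_nat | simp add: enc_eq_iffs)+)[1],
        simp add: enc_eq_iffs, simp add: algebra_simps)
  next
    case 3
    with c show ?thesis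
      by - (rule scan_fnI[unfolded scan_body_def],
        ((rule ev_intros call_equal_nat IH | simp add: enc_eq_iffs)+)[1],
        simp add: enc_eq_iffs, simp add: algebra_simps)
  qed
qed

lemma call_scan:
  assumes "ok_list N L"
  shows "call scan_fn [enc_nats L, enc_opt x, enc_opt y] (sbool (scan L x y)) (scan_time N)"
  by (rule fn_ev_mono[OF call_scan_aux])
    (use assms in \<open>auto simp: ok_list_def scan_time_def intro!: mult_le_mono\<close>)

lemma call_dominated_aux:
  assumes "\<forall>L\<in>set P. ok_list N L" "ok_list N h" "ok_list N g"
  shows "call dominated_fn [enc_layer P, enc_nat a, enc_nats h, enc_nats g]
    (sbool (dominated P a h g)) ((length P + 1) * (scan_time N + 2 * find_time N + 60))"
  using assms
proof (induction P arbitrary: a)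
  case Nil
  show ?case
    by - (rule dominated_fnI[unfolded dominated_body_def],
        ((rule ev_intros | simp add: enc_eq_iffs)+)[1],
        simp add: enc_eq_iffs, simp add: algebra_simps)
next
  case (Cons L P)
  note IH = Cons.IH[of "Suc a", simplified]
  show ?case
  proof (cases "scan L (find_item h a 0) (find_item g a 0)")
    case True
    with Cons.prems show ?thesis
      by - (rule dominated_fnI[unfolded dominated_body_def],
        ((rule ev_intros call_scan call_find IH | simp add: enc_eq_iffs)+)[1],
        simp add: enc_eq_iffs, simp add: algebra_simps)
  next
    case False
    with Cons.prems show ?thesis
      by - (rule dominated_fnI[unfolded dominated_body_def],
        ((rule ev_intros call_scan call_find IH | simp add: enc_eq_iffs)+)[1],
        simp add: enc_eq_iffs, simp add: algebra_simps)
  qed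
qed

lemma call_dominated:
  assumes "\<forall>L\<in>set P. ok_list N L" "length P \<le> N" "ok_list N h" "ok_list N g"
  shows "call dominated_fn [enc_layer P, Atom, enc_nats h, enc_nats g]
    (sbool (dominated P 0 h g)) (dominated_time N)"
proof -
  have "call dominated_fn [enc_layer P, enc_nat 0, enc_nats h, enc_nats g]
    (sbool (dominated P 0 h g)) (dominated_time N)"
    by (rule fn_ev_mono[OF call_dominated_aux]) (use assms in \<open>auto simp: dominated_time_def\<close>)
  then show ?thesis by simp
qed

lemma call_differ_aux:
  assumes "ok_list N h" "ok_list N g"
  shows "call differ_fn [enc_nat a, enc_nats h, enc_nats g]
    (sbool (\<exists>i<a. find_item h i 0 \<noteq> find_item g i 0))
    ((a + 1) * (2 * find_time N + 30 * N + 115))"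
proof (induction a)
  case 0
  show ?case
    by - (rule differ_fnI[unfolded differ_body_def],
        ((rule ev_intros | simp add: enc_eq_iffs)+)[1],
        simp add: enc_eq_iffs, simp add: algebra_simps)
next
  case (Suc a)
  \<comment> \<open>The cost of a comparison depends on its first argument only, which is the item
    received under \<open>h\<close>.\<close>
  have ok: "case find_item h a 0 of None \<Rightarrow> True | Some c \<Rightarrow> c \<le> N"
    using find_item_SomeD[of h a 0] assms by (fastforce simp: ok_list_def split: option.splits)
  show ?case
  proof (cases "find_item h a 0 = find_item g a 0")
    case True
    then have *: "(\<exists>i<Suc a. find_item h i 0 \<noteq> find_item g i 0)
        \<longleftrightarrow> (\<exists>i<a. find_item h i 0 \<noteq> find_item g i 0)"
      by (metis less_Suc_eq)
    from True assms ok show ?thesis unfolding *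
      by - (rule differ_fnI[unfolded differ_body_def],
        ((rule ev_intros call_find call_equal_opt Suc.IH | simp add: enc_eq_iffs)+)[1],
        simp add: enc_eq_iffs, simp add: algebra_simps)
  next
    case False
    then have *: "(\<exists>i<Suc a. find_item h i 0 \<noteq> find_item g i 0) \<longleftrightarrow> True"
      by blast
    from False assms ok show ?thesis unfolding *
      by - (rule differ_fnI[unfolded differ_body_def],
        ((rule ev_intros call_find call_equal_opt Suc.IH | simp add: enc_eq_iffs)+)[1],
        simp add: enc_eq_iffs, simp add: algebra_simps)
  qed
qed

lemma call_differ:
  assumes "ok_list N h" "ok_list N g" "a \<le> N"
  shows "call differ_fn [enc_nat a, enc_nats h, enc_nats g]
    (sbool (\<exists>i<a. find_item h i 0 \<noteq> find_item g i 0)) (differ_time N)"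
  by (rule fn_ev_mono[OF call_differ_aux])
    (use assms in \<open>auto simp: differ_time_def intro!: mult_le_mono\<close>)

text \<open>Two loops share one function, so there are two inductions: on the number
  \<open>k\<close> of entries still to be chosen, and inside it on the value \<open>v\<close> from
  which the next entry is counted down. The outer hypothesis is applied to prefixes extended by that
  value.\<close>

lemma call_improve:
  assumes P: "\<forall>L\<in>set P. ok_list N L" "length P \<le> N" and h: "ok_list N h" and n: "n \<le> N"
    and g: "set g \<subseteq> {..n}" "length g + k \<le> N"
  shows "call improve_fn [enc_nat k, enc_nat n, enc_nats g, enc_nat n, enc_layer P, enc_nats h]
    (sbool (search (improves n P h) n k g)) (search_time (leaf_time N) n k)"
  using g
proof (induction k arbitrary: g)
  case 0
  then have "ok_list N g"
    using n by (auto simp: ok_list_def)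
  with P h n show ?case
    by (cases "dominated P 0 h g") (rule improve_fnI[unfolded improve_body_def],
      ((rule ev_intros call_dominated call_differ | simp)+)[1],
      simp add: improves_def, simp add: leaf_time_def)+
next
  case (Suc k)
  note outer_IH = Suc.IH
  have "call improve_fn [enc_nat (Suc k), enc_nat v, enc_nats g, enc_nat n, enc_layer P, enc_nats h]
    (sbool (\<exists>w\<le>v. search (improves n P h) n k (w # g)))
    ((v + 1) * (leaf_time N + search_time (leaf_time N) n k))" if "v \<le> n" for v
    using that
  proof (induction v)
    case 0
    have g': "set (0 # g) \<subseteq> {..n}" "length (0 # g) + k \<le> N" using Suc.prems by auto
    note IH = Suc.IH[OF g', simplified]
    \<comment> \<open>The first argument of \<open>search_time\<close> also pays for each step of
      the loop over the values, so it must cover that constant overhead.\<close>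
    have lf: "60 \<le> leaf_time N" by (simp add: leaf_time_def)
    show ?case
    proof (cases "search (improves n P h) n k (0 # g)")
      case True
      with lf show ?thesis
        by - (rule improve_fnI[unfolded improve_body_def],
        ((rule ev_intros IH | simp add: enc_eq_iffs)+)[1],
        simp add: enc_eq_iffs, simp add: algebra_simps)
    next
      case False
      with lf show ?thesis
        by - (rule improve_fnI[unfolded improve_body_def],
        ((rule ev_intros IH | simp add: enc_eq_iffs)+)[1],
        simp add: enc_eq_iffs, simp add: algebra_simps)
    qed
  next
    case (Suc v)
    have g': "set (Suc v # g) \<subseteq> {..n}" "length (Suc v # g) + k \<le> N"
      using Suc.prems \<open>set g \<subseteq> {..n}\<close> \<open>length g + Suc k \<le> N\<close> by auto
    note IH = outer_IH[OF g', simplified] Suc.IH[simplified]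
    have *: "(\<exists>w\<le>Suc v. search (improves n P h) n k (w # g)) \<longleftrightarrow>
      search (improves n P h) n k (Suc v # g) \<or> (\<exists>w\<le>v. search (improves n P h) n k (w # g))"
      using le_Suc_eq by auto
    have lf: "60 \<le> leaf_time N" by (simp add: leaf_time_def)
    show ?case
    proof (cases "search (improves n P h) n k (Suc v # g)")
      case True
      with lf Suc.prems show ?thesis unfolding *
        by - (rule improve_fnI[unfolded improve_body_def],
        ((rule ev_intros IH | simp add: enc_eq_iffs)+)[1],
        simp add: enc_eq_iffs, simp add: algebra_simps)
    next
      case False
      with lf Suc.prems show ?thesis unfolding *
        by - (rule improve_fnI[unfolded improve_body_def],
        ((rule ev_intros IH | simp add: enc_eq_iffs)+)[1],
        simp add: enc_eq_iffs, simp add: algebra_simps)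
    qed
  qed
  from this[of n] show ?case by simp
qed

lemma call_count_aux:
  assumes "\<forall>P\<in>set Ps. length P \<le> N \<and> (\<forall>L\<in>set P. ok_list N L)"
    and h: "ok_list N h" and n: "n \<le> N" and m: "m \<le> N"
  shows "call count_fn [enc_layers Ps, enc_nat \<alpha>, enc_nats h, enc_nat n, enc_nat m]
    (sbool (\<alpha> \<le> length (filter (\<lambda>P. po_list n m P h) Ps)))
    ((length Ps + 1) * (dominated_time N + search_time (leaf_time N) n m + 60))"
  using assms(1)
proof (induction Ps arbitrary: \<alpha>)
  case Nil
  show ?case
  proof (cases \<alpha>)
    case 0
    then show ?thesis
      by - (rule count_fnI[unfolded count_body_def],
        ((rule ev_intros | simp add: enc_eq_iffs)+)[1],
        simp add: enc_eq_iffs, simp add: algebra_simps)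
  next
    case (Suc k)
    then show ?thesis
      by - (rule count_fnI[unfolded count_body_def],
        ((rule ev_intros | simp add: enc_eq_iffs)+)[1],
        simp add: enc_eq_iffs, simp add: algebra_simps)
  qed
next
  case (Cons P Ps)
  then have P: "\<forall>L\<in>set P. ok_list N L" "length P \<le> N"
    and Ps: "\<forall>P\<in>set Ps. length P \<le> N \<and> (\<forall>L\<in>set P. ok_list N L)" by auto
  have nil: "ok_list N []" by (simp add: ok_list_def)
  note facts = call_dominated[OF P nil h, simplified] call_improve[OF P h n, of "[]", simplified, OF m]
    Cons.IH[OF Ps] Cons.IH[OF Ps, of "Suc _", simplified]
  show ?case
  proof (cases \<alpha>)
    case 0
    then show ?thesis
      by - (rule count_fnI[unfolded count_body_def],
        ((rule ev_intros | simp add: enc_eq_iffs)+)[1],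
        simp add: enc_eq_iffs, simp add: algebra_simps)
  next
    case (Suc k)
    consider "\<not> dominated P 0 [] h" | "dominated P 0 [] h" "search (improves n P h) n m []"
      | "dominated P 0 [] h" "\<not> search (improves n P h) n m []" by blast
    then show ?thesis
    proof cases
      case 1
      with Suc show ?thesis
        by - (rule count_fnI[unfolded count_body_def],
        ((rule ev_intros facts | simp add: enc_eq_iffs po_list_def)+)[1],
        simp add: enc_eq_iffs po_list_def, simp add: algebra_simps)
    next
      case 2
      with Suc show ?thesis
        by - (rule count_fnI[unfolded count_body_def],
        ((rule ev_intros facts | simp add: enc_eq_iffs po_list_def)+)[1],
        simp add: enc_eq_iffs po_list_def, simp add: algebra_simps)
    next
      case 3
      with Suc show ?thesis
        by - (rule count_fnI[unfolded count_body_def],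
        ((rule ev_intros facts | simp add: enc_eq_iffs po_list_def)+)[1],
        simp add: enc_eq_iffs po_list_def, simp add: algebra_simps)
    qed
  qed
qed

lemma call_count:
  assumes "ok_layers N n Ps" and h: "ok_list N h" and m: "m \<le> N"
  shows "call count_fn [enc_layers Ps, enc_nat \<alpha>, enc_nats h, enc_nat n, enc_nat m]
    (sbool (\<alpha> \<le> length (filter (\<lambda>P. po_list n m P h) Ps))) (count_time N n m)"
  by (rule fn_ev_mono[OF call_count_aux])
    (use assms in \<open>auto simp: count_time_def ok_layers_def intro!: mult_le_mono\<close>)

text \<open>The same double induction as for \<open>call_improve\<close>. The added 60 pays for a
  loop step and for the call at a leaf.\<close>

lemma call_search:
  assumes G: "ok_layers N (num_agents G) (profiles G)" and m: "num_items G \<le> N"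
    and g: "set g \<subseteq> {..num_agents G}" "length g + k \<le> N"
  defines "Q \<equiv> (\<lambda>h. threshold G \<le>
     length (filter (\<lambda>P. po_list (num_agents G) (num_items G) P h) (profiles G)))"
  shows "call search_fn [enc_nat k, enc_nat (num_agents G), enc_nats g, encode G]
    (sbool (search Q (num_agents G) k g))
    (search_time (count_time N (num_agents G) (num_items G) + 60) (num_agents G) k)"
  using g
proof (induction k arbitrary: g)
  case 0
  then have "ok_list N g"
    using G by (auto simp: ok_list_def ok_layers_def)
  note cnt = call_count[OF G this m]
  show ?case
    by - (rule search_fnI[unfolded search_body_def],
        ((rule ev_intros cnt | simp add: enc_eq_iffs Q_def)+)[1],
        simp add: enc_eq_iffs Q_def, simp add: algebra_simps)
next
  case (Suc k)
  let ?K = "count_time N (num_agents G) (num_items G) + 60"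
  let ?n = "num_agents G"
  note outer_IH = Suc.IH
  have "call search_fn [enc_nat (Suc k), enc_nat v, enc_nats g, encode G]
    (sbool (\<exists>w\<le>v. search Q ?n k (w # g)))
    ((v + 1) * (?K + search_time ?K ?n k))" if "v \<le> ?n" for v
    using that
  proof (induction v)
    case 0
    have g': "set (0 # g) \<subseteq> {..?n}" "length (0 # g) + k \<le> N" using Suc.prems by auto
    note IH = outer_IH[OF g', simplified]
    show ?case
    proof (cases "search Q ?n k (0 # g)")
      case True
      then show ?thesis
        by - (rule search_fnI[unfolded search_body_def],
        ((rule ev_intros IH | simp add: enc_eq_iffs)+)[1],
        simp add: enc_eq_iffs, simp add: algebra_simps)
    next
      case False
      then show ?thesis
        by - (rule search_fnI[unfolded search_body_def],
        ((rule ev_intros IH | simp add: enc_eq_iffs)+)[1],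
        simp add: enc_eq_iffs, simp add: algebra_simps)
    qed
  next
    case (Suc v)
    have g': "set (Suc v # g) \<subseteq> {..?n}" "length (Suc v # g) + k \<le> N"
      using Suc.prems \<open>set g \<subseteq> {..?n}\<close> \<open>length g + Suc k \<le> N\<close> by auto
    note IH = outer_IH[OF g', simplified] Suc.IH[simplified]
    have *: "(\<exists>w\<le>Suc v. search Q ?n k (w # g)) \<longleftrightarrow>
      search Q ?n k (Suc v # g) \<or> (\<exists>w\<le>v. search Q ?n k (w # g))"
      using le_Suc_eq by auto
    show ?case
    proof (cases "search Q ?n k (Suc v # g)")
      case True
      with Suc.prems show ?thesis unfolding *
        by - (rule search_fnI[unfolded search_body_def],
        ((rule ev_intros IH | simp add: enc_eq_iffs)+)[1],
        simp add: enc_eq_iffs, simp add: algebra_simps)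
    next
      case False
      with Suc.prems show ?thesis unfolding *
        by - (rule search_fnI[unfolded search_body_def],
        ((rule ev_intros IH | simp add: enc_eq_iffs)+)[1],
        simp add: enc_eq_iffs, simp add: algebra_simps)
    qed
  qed
  from this[of ?n] show ?case by simp
qed

lemma call_solve:
  assumes G: "ok_layers N (num_agents G) (profiles G)" and m: "num_items G \<le> N"
  shows "call solve_fn [encode G] (sbool (solve G)) (solve_time N (num_agents G) (num_items G))"
proof -
  note exp = call_search[OF G m, of "[]", simplified, OF m]
  show ?thesis
    by - (rule solve_fnI[unfolded solve_body_def],
        ((rule ev_intros exp | simp add: enc_eq_iffs solve_def)+)[1],
        simp add: enc_eq_iffs solve_def, simp add: algebra_simps solve_time_def)
qed

lemma call_up:
  assumes "ok_list N L"
  shows "call up_fn [enc_nat b, enc_nats L] (enc_nats (up b L)) (up_time N)"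
proof -
  have "call up_fn [enc_nat b, enc_nats L] (enc_nats (up b L)) ((length L + 1) * (30 * N + 100))"
    if "set L \<subseteq> {..N}" using that
  proof (induction L)
    case Nil
    show ?case
      by - (rule up_fnI[unfolded up_body_def],
        ((rule ev_intros | simp add: enc_eq_iffs)+)[1],
        simp add: enc_eq_iffs, simp add: algebra_simps)
  next
    case (Cons x L)
    then have x: "x \<le> N" and L: "set L \<subseteq> {..N}" by auto
    note IH = Cons.IH[OF L]
    show ?case
    proof (cases "x = b")
      case True
      with x show ?thesis
        by - (rule up_fnI[unfolded up_body_def],
        ((rule ev_intros call_equal_nat | simp add: enc_eq_iffs)+)[1],
        simp add: enc_eq_iffs, simp add: algebra_simps)
    next
      case False
      with x show ?thesis
        by - (rule up_fnI[unfolded up_body_def],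
        ((rule ev_intros call_equal_nat IH | simp add: enc_eq_iffs)+)[1],
        simp add: enc_eq_iffs, simp add: algebra_simps)
    qed
  qed
  from this show ?thesis
    by (rule fn_ev_mono) (use assms in \<open>auto simp: ok_list_def up_time_def intro!: mult_le_mono\<close>)
qed

lemma call_nth:
  assumes "a < length P" "a \<le> N"
  shows "call nth_fn [enc_layer P, enc_nat a] (enc_nats (P ! a)) (20 * N + 20)"
proof -
  have "call nth_fn [enc_layer P, enc_nat a] (enc_nats (P ! a)) (20 * a + 20)"
    using assms(1)
  proof (induction a arbitrary: P)
    case 0
    then obtain L P' where "P = L # P'" by (cases P) auto
    then show ?case
      by - (rule nth_fnI[unfolded nth_body_def],
        ((rule ev_intros | simp add: enc_eq_iffs)+)[1],
        simp add: enc_eq_iffs, simp add: algebra_simps)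
  next
    case (Suc a)
    then obtain L P' where P: "P = L # P'" and a: "a < length P'" by (cases P) auto
    note IH = Suc.IH[OF a]
    from P show ?case
      by - (rule nth_fnI[unfolded nth_body_def],
        ((rule ev_intros IH | simp add: enc_eq_iffs)+)[1],
        simp add: enc_eq_iffs, simp add: algebra_simps)
  qed
  then show ?thesis
    by (rule fn_ev_mono) (use assms in auto)
qed

lemma call_sig:
  assumes "ok_layers N n Ps" "a < n"
  shows "call sig_fn [enc_layers Ps, enc_nat a, enc_nat b] (enc_layer (sig Ps a b)) (sig_time N)"
proof -
  have a: "a \<le> N" using assms by (auto simp: ok_layers_def)
  have "call sig_fn [enc_layers Ps, enc_nat a, enc_nat b] (enc_layer (sig Ps a b))
    ((length Ps + 1) * (up_time N + 20 * N + 60))"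
    if "\<forall>P\<in>set Ps. length P = n \<and> (\<forall>L\<in>set P. ok_list N L)" using that
  proof (induction Ps)
    case Nil
    show ?case
      by - (rule sig_fnI[unfolded sig_body_def],
        ((rule ev_intros | simp add: enc_eq_iffs sig_def)+)[1],
        simp add: enc_eq_iffs sig_def, simp add: algebra_simps)
  next
    case (Cons P Ps)
    then have P: "ok_list N (P ! a)" "a < length P"
      using assms(2) by auto
    note facts = call_up[OF P(1)] call_nth[OF P(2) a]
    from Cons have IH: "call sig_fn [enc_layers Ps, enc_nat a, enc_nat b] (enc_layer (sig Ps a b))
      ((length Ps + 1) * (up_time N + 20 * N + 60))" by simp
    show ?case
      by - (rule sig_fnI[unfolded sig_body_def],
        ((rule ev_intros facts IH | simp add: enc_eq_iffs sig_def)+)[1],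
        simp add: enc_eq_iffs sig_def, simp add: algebra_simps)
  qed
  from this show ?thesis
    by (rule fn_ev_mono) (use assms in \<open>auto simp: ok_layers_def sig_time_def intro!: mult_le_mono\<close>)
qed

lemma call_equal_sig:
  assumes "ok_layers N n Ps" "a < n"
  shows "call equal_fn [enc_layer (sig Ps a b), v]
    (sbool (enc_layer (sig Ps a b) = v)) (sig_equal_time N)"
  by (rule fn_ev_mono[OF call_equal])
    (use nodes_sig_le[OF assms, of b] in \<open>simp_all add: sig_equal_time_def\<close>)

lemma call_few:
  assumes ok: "ok_layers N n Ps" and "a \<le> n"
  shows "call few_fn [enc_nat k, enc_nat a, enc_layer s, enc_nat b, enc_layers Ps]
    (sbool (card {i. i < a \<and> sig Ps i b = s} \<le> k)) (few_time N)"
proof -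
  have "call few_fn [enc_nat k, enc_nat a, enc_layer s, enc_nat b, enc_layers Ps]
    (sbool (card {i. i < a \<and> sig Ps i b = s} \<le> k))
    ((a + 1) * (sig_time N + sig_equal_time N + 60))"
    using assms(2)
  proof (induction a arbitrary: k)
    case 0
    show ?case
      by - (rule few_fnI[unfolded few_body_def],
        ((rule ev_intros | simp add: enc_eq_iffs)+)[1],
        simp add: enc_eq_iffs, simp add: algebra_simps)
  next
    case (Suc a)
    then have a: "a < n" by simp
    note facts = call_sig[OF ok a] call_equal_sig[OF ok a] Suc.IH[OF less_imp_le[OF a]]
    show ?case
    proof (cases "sig Ps a b = s")
      case True
      then have "{i. i < Suc a \<and> sig Ps i b = s} = insert a {i. i < a \<and> sig Ps i b = s}"
        by (auto simp: less_Suc_eq)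
      then have *: "card {i. i < Suc a \<and> sig Ps i b = s} = Suc (card {i. i < a \<and> sig Ps i b = s})"
        by simp
      show ?thesis
      proof (cases k)
        case 0
        with True show ?thesis unfolding *
          by - (rule few_fnI[unfolded few_body_def],
        ((rule ev_intros facts | simp add: enc_eq_iffs)+)[1],
        simp add: enc_eq_iffs, simp add: algebra_simps)
      next
        case (Suc k')
        with True show ?thesis unfolding *
          by - (rule few_fnI[unfolded few_body_def],
        ((rule ev_intros facts | simp add: enc_eq_iffs)+)[1],
        simp add: enc_eq_iffs, simp add: algebra_simps)
      qed
    next
      case False
      then have *: "{i. i < Suc a \<and> sig Ps i b = s} = {i. i < a \<and> sig Ps i b = s}"
        by (auto simp: less_Suc_eq)
      from False show ?thesis unfolding *
        by - (rule few_fnI[unfolded few_body_def],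
        ((rule ev_intros facts | simp add: enc_eq_iffs)+)[1],
        simp add: enc_eq_iffs, simp add: algebra_simps)
    qed
  qed
  from this show ?thesis
    by (rule fn_ev_mono) (use assms in \<open>auto simp: ok_layers_def few_time_def intro!: mult_le_mono\<close>)
qed

lemma call_kept:
  assumes ok: "ok_layers N n Ps" and a: "a < n" and m: "m \<le> N"
  shows "call kept_fn [enc_nat a, enc_nat m, enc_nat m, enc_layers Ps]
    (sbool (kept Ps m a)) (kept_time N)"
proof -
  \<comment> \<open>The loop counter is separated from the budget \<open>m\<close>, which stays
    fixed during the recursion.\<close>
  have "call kept_fn [enc_nat a, enc_nat b, enc_nat m, enc_layers Ps]
    (sbool (\<exists>b'<b. few_before Ps m a b')) ((b + 1) * (few_time N + sig_time N + 60))" for b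
  proof (induction b)
    case 0
    show ?case
      by - (rule kept_fnI[unfolded kept_body_def],
        ((rule ev_intros | simp add: enc_eq_iffs)+)[1],
        simp add: enc_eq_iffs, simp add: algebra_simps)
  next
    case (Suc b)
    have *: "(\<exists>b'<Suc b. few_before Ps m a b') \<longleftrightarrow>
      few_before Ps m a b \<or> (\<exists>b'<b. few_before Ps m a b')"
      by (auto simp: less_Suc_eq)
    have few: "call few_fn [enc_nat m, enc_nat a, enc_layer (sig Ps a b), enc_nat b, enc_layers Ps]
      (sbool (few_before Ps m a b)) (few_time N)"
      unfolding few_before_def by (rule call_few[OF ok less_imp_le[OF a]])
    note facts = few call_sig[OF ok a] Suc.IH
    show ?case
    proof (cases "few_before Ps m a b")
      case True
      then show ?thesis unfolding *
        by - (rule kept_fnI[unfolded kept_body_def],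
        ((rule ev_intros facts | simp add: enc_eq_iffs)+)[1],
        simp add: enc_eq_iffs, simp add: algebra_simps)
    next
      case False
      then show ?thesis unfolding *
        by - (rule kept_fnI[unfolded kept_body_def],
        ((rule ev_intros facts | simp add: enc_eq_iffs)+)[1],
        simp add: enc_eq_iffs, simp add: algebra_simps)
    qed
  qed
  from this[of m] show ?thesis
    by (rule fn_ev_mono) (use m in \<open>auto simp: kept_def kept_time_def intro!: mult_le_mono\<close>)
qed

lemma call_select:
  assumes ok: "ok_layers N n Ps" and m: "m \<le> N" and P: "length P = n"
  shows "call select_fn [enc_layer P, Atom, enc_nat m, enc_layers Ps]
    (enc_layer (select_from (kept Ps m) P 0)) (select_time N)"
proof -
  have "call select_fn [enc_layer P, enc_nat a, enc_nat m, enc_layers Ps]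
    (enc_layer (select_from (kept Ps m) P a)) ((length P + 1) * (kept_time N + 60))"
    if "a + length P = n" for a using that
  proof (induction P arbitrary: a)
    case Nil
    show ?case
      by - (rule select_fnI[unfolded select_body_def],
        ((rule ev_intros | simp add: enc_eq_iffs)+)[1],
        simp add: enc_eq_iffs, simp add: algebra_simps)
  next
    case (Cons L P)
    then have a: "a < n" and "Suc a + length P = n" by auto
    note facts = Cons.IH[OF this(2), simplified] call_kept[OF ok a m]
    show ?case
    proof (cases "kept Ps m a")
      case True
      then show ?thesis
        by - (rule select_fnI[unfolded select_body_def],
        ((rule ev_intros facts | simp add: enc_eq_iffs)+)[1],
        simp add: enc_eq_iffs, simp add: algebra_simps)
    next
      case False
      then show ?thesis
        by - (rule select_fnI[unfolded select_body_def],
        ((rule ev_intros facts | simp add: enc_eq_iffs)+)[1],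
        simp add: enc_eq_iffs, simp add: algebra_simps)
    qed
  qed
  from this[of 0] P have "call select_fn [enc_layer P, Atom, enc_nat m, enc_layers Ps]
    (enc_layer (select_from (kept Ps m) P 0)) ((length P + 1) * (kept_time N + 60))"
    by simp
  then show ?thesis
    by (rule fn_ev_mono) (use assms in \<open>auto simp: ok_layers_def select_time_def intro!: mult_le_mono\<close>)
qed

lemma call_select_all:
  assumes ok: "ok_layers N n Ps" and m: "m \<le> N"
  shows "call select_all_fn [enc_layers Ps, enc_nat m, enc_layers Ps]
    (enc_layers (map (\<lambda>P. select_from (kept Ps m) P 0) Ps)) (select_all_time N)"
proof -
  \<comment> \<open>The layers being traversed are separated from those that determine which agents
    are kept.\<close>
  have "call select_all_fn [enc_layers Qs, enc_nat m, enc_layers Ps]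
    (enc_layers (map (\<lambda>P. select_from (kept Ps m) P 0) Qs)) ((length Qs + 1) * (select_time N + 40))"
    if "\<forall>Q\<in>set Qs. length Q = n" for Qs using that
  proof (induction Qs)
    case Nil
    show ?case
      by - (rule select_all_fnI[unfolded select_all_body_def],
        ((rule ev_intros | simp add: enc_eq_iffs)+)[1],
        simp add: enc_eq_iffs, simp add: algebra_simps)
  next
    case (Cons Q Qs)
    then have Q: "length Q = n" and Qs: "\<forall>Q\<in>set Qs. length Q = n" by auto
    note facts = call_select[OF ok m Q] Cons.IH[OF Qs]
    show ?case
      by - (rule select_all_fnI[unfolded select_all_body_def],
        ((rule ev_intros facts | simp add: enc_eq_iffs)+)[1],
        simp add: enc_eq_iffs, simp add: algebra_simps)
  qed
  moreover have "\<forall>Q\<in>set Ps. length Q = n"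
    using ok by (simp add: ok_layers_def)
  ultimately have "call select_all_fn [enc_layers Ps, enc_nat m, enc_layers Ps]
    (enc_layers (map (\<lambda>P. select_from (kept Ps m) P 0) Ps)) ((length Ps + 1) * (select_time N + 40))"
    by blast
  then show ?thesis
    by (rule fn_ev_mono) (use ok in \<open>simp_all add: ok_layers_def select_all_time_def mult_le_mono\<close>)
qed

lemma call_num_kept:
  assumes ok: "ok_layers N n Ps" and m: "m \<le> N"
  shows "call num_kept_fn [enc_nat n, enc_nat m, enc_layers Ps]
    (enc_nat (card {i. i < n \<and> kept Ps m i})) (num_kept_time N)"
proof -
  have "call num_kept_fn [enc_nat a, enc_nat m, enc_layers Ps]
    (enc_nat (card {i. i < a \<and> kept Ps m i})) ((a + 1) * (kept_time N + 60))" if "a \<le> n" for a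
    using that
  proof (induction a)
    case 0
    show ?case
      by - (rule num_kept_fnI[unfolded num_kept_body_def],
        ((rule ev_intros | simp add: enc_eq_iffs)+)[1],
        simp add: enc_eq_iffs, simp add: algebra_simps)
  next
    case (Suc a)
    then have a: "a < n" by simp
    note facts = Suc.IH[OF less_imp_le[OF a]] call_kept[OF ok a m]
    show ?case
    proof (cases "kept Ps m a")
      case True
      then have "{i. i < Suc a \<and> kept Ps m i} = insert a {i. i < a \<and> kept Ps m i}"
        by (auto simp: less_Suc_eq)
      then have *: "card {i. i < Suc a \<and> kept Ps m i} = Suc (card {i. i < a \<and> kept Ps m i})"
        by simp
      from True show ?thesis unfolding *
        by - (rule num_kept_fnI[unfolded num_kept_body_def],
        ((rule ev_intros facts | simp add: enc_eq_iffs)+)[1],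
        simp add: enc_eq_iffs, simp add: algebra_simps)
    next
      case False
      then have *: "{i. i < Suc a \<and> kept Ps m i} = {i. i < a \<and> kept Ps m i}"
        by (auto simp: less_Suc_eq)
      from False show ?thesis unfolding *
        by - (rule num_kept_fnI[unfolded num_kept_body_def],
        ((rule ev_intros facts | simp add: enc_eq_iffs)+)[1],
        simp add: enc_eq_iffs, simp add: algebra_simps)
    qed
  qed
  from this[OF order_refl] show ?thesis
    by (rule fn_ev_mono) (use ok in \<open>simp_all add: ok_layers_def num_kept_time_def mult_le_mono\<close>)
qed

lemma call_reduce:
  assumes ok: "ok_layers N (num_agents G) (profiles G)" and m: "num_items G \<le> N"
  shows "call reduce_fn [encode G] (encode (reduce G)) (reduce_time N)"
proof -
  note facts = call_num_kept[OF ok m] call_select_all[OF ok m]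
  have *: "encode (reduce G) =
     Pair (enc_nat (card {i. i < num_agents G \<and> kept (profiles G) (num_items G) i}))
       (Pair (enc_nat (num_items G))
         (Pair (enc_nat (threshold G)) (enc_layers
           (map (\<lambda>P. select_from (kept (profiles G) (num_items G)) P 0) (profiles G)))))"
    by (simp add: encode_def reduce_def)
  show ?thesis unfolding *
    by - (rule reduce_fnI[unfolded reduce_body_def],
        ((rule ev_intros facts | simp add: enc_eq_iffs)+)[1],
        simp add: enc_eq_iffs, simp add: algebra_simps reduce_time_def)
qed

end

section \<open>Correctness of the search\<close>

lemma set_up_iff: "b \<in> set (up b L) \<longleftrightarrow> b \<in> set L"
  by (induction L) auto

text \<open>Acceptability of \<open>b\<close> passes from an agent to every
  \<open>b\<close>-equivalent one.\<close>

lemma up_self_mem: "up b L = up b L' \<Longrightarrow> b \<in> set L \<Longrightarrow> b \<in> set L'"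
  by (metis set_up_iff)

lemma worse_irrefl: "distinct L \<Longrightarrow> \<not> worse L x x"
  by (cases x) (auto simp: distinct_conv_nth)

text \<open>Turns the definition by positions into a recursion along the list.\<close>

lemma worse_Some_Cons:
  assumes "b \<noteq> x"
  shows "worse (x # xs) (Some b) (Some c) \<longleftrightarrow> c = x \<and> b \<in> set xs \<or> worse xs (Some b) (Some c)"
proof
  assume "worse (x # xs) (Some b) (Some c)"
  then obtain i k where ik: "i < k" "k < length (x # xs)" "(x # xs) ! i = c" "(x # xs) ! k = b"
    by auto
  then obtain k' where k: "k = Suc k'" by (cases k) auto
  show "c = x \<and> b \<in> set xs \<or> worse xs (Some b) (Some c)"
  proof (cases i)
    case 0
    then show ?thesis using ik k by auto
  next
    case (Suc i')
    then show ?thesis using ik k by auto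
  qed
next
  assume "c = x \<and> b \<in> set xs \<or> worse xs (Some b) (Some c)"
  then show "worse (x # xs) (Some b) (Some c)"
  proof
    assume *: "c = x \<and> b \<in> set xs"
    then obtain k where "k < length xs" "xs ! k = b" by (auto simp: in_set_conv_nth)
    then show ?thesis using * unfolding worse.simps by (intro exI[of _ 0] exI[of _ "Suc k"]) simp
  next
    assume "worse xs (Some b) (Some c)"
    then obtain i k where "i < k" "k < length xs" "xs ! i = c" "xs ! k = b" by auto
    then show ?thesis unfolding worse.simps by (intro exI[of _ "Suc i"] exI[of _ "Suc k"]) simp
  qed
qed

text \<open>The fact behind the classes: how the holder of an acceptable \<open>b\<close> rates any
  outcome depends only on the list down to \<open>b\<close>. In particular, giving up
  \<open>b\<close> for nothing is never acceptable.\<close>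

lemma worse_eq_up:
  assumes "distinct L" "b \<in> set L"
  shows "worse_eq L (Some b) y \<longleftrightarrow> (\<exists>c\<in>set (up b L). y = Some c)"
  using assms
proof (induction L)
  case (Cons x xs)
  show ?case
  proof (cases "x = b")
    case True
    have "\<not> worse (x # xs) (Some b) y"
    proof
      assume "worse (x # xs) (Some b) y"
      then obtain i k where ik: "i < k" "k < length (x # xs)" "(x # xs) ! k = b"
        by (cases y) auto
      \<comment> \<open>By distinctness \<open>b\<close> occurs at position 0 only, and nothing
        precedes that position.\<close>
      then have "k = 0"
        using True Cons.prems by (cases k) auto
      with ik show False by simp
    qed
    then show ?thesis using True by (auto simp: worse_eq_def)
  next
    case False
    then have "worse_eq xs (Some b) y \<longleftrightarrow> (\<exists>c\<in>set (up b xs). y = Some c)"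
      using Cons by auto
    moreover have "worse_eq (x # xs) (Some b) y \<longleftrightarrow> y = Some x \<or> worse_eq xs (Some b) y"
      using False Cons.prems
      by (cases y) (auto simp: worse_eq_def worse_Some_Cons simp del: worse.simps(3))
    ultimately show ?thesis using False by auto
  qed
qed simp

lemma worse_eq_None: "worse_eq L None y \<longleftrightarrow> set_option y \<subseteq> set L"
  by (cases y) (auto simp: worse_eq_def)

text \<open>An agent that starts within its list and does not lose stays within it. Hence domination
  of a legal assignment already implies acceptability.\<close>

lemma worse_eq_SomeD:
  assumes "distinct L" "set_option x \<subseteq> set L" "worse_eq L x y"
  shows "set_option y \<subseteq> set L"
proof (cases x)
  case None
  then show ?thesis using assms by (simp add: worse_eq_None)
next
  case (Some b)
  then show ?thesis using assms set_up_subset[of b L] by (auto simp: worse_eq_up)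
qed

lemma scan_None: "scan L None y \<longleftrightarrow> set_option y \<subseteq> set L"
  by (cases y; induction L) auto

lemma scan_Some: "b \<in> set L \<Longrightarrow> scan L (Some b) y \<longleftrightarrow> (\<exists>c\<in>set (up b L). y = Some c)"
  by (induction L) auto

text \<open>The assumption on \<open>x\<close> matters: if \<open>x\<close> were an item outside the
  list, the pass would never meet it and would accept \<open>None\<close> in its place.\<close>

lemma scan_iff:
  assumes "distinct L" "set_option x \<subseteq> set L"
  shows "scan L x y \<longleftrightarrow> worse_eq L x y"
  using assms by (cases x) (auto simp: scan_None worse_eq_None scan_Some worse_eq_up)

lemma dominated_iff:
  "dominated P a h g \<longleftrightarrow>
    (\<forall>i<length P. scan (P ! i) (find_item h (a + i) 0) (find_item g (a + i) 0))"
proof (induction P arbitrary: a)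
  case (Cons L P)
  show ?case
    by (simp add: Cons.IH All_less_Suc2)
qed simp

lemma search_iff:
  "search Q n k g \<longleftrightarrow> (\<exists>us. length us = k \<and> set us \<subseteq> {..n} \<and> Q (us @ g))"
proof (induction k arbitrary: g)
  case (Suc k)
  show ?case
  proof
    assume "search Q n (Suc k) g"
    then obtain v us where "v \<le> n" "length us = k" "set us \<subseteq> {..n}" "Q (us @ v # g)"
      by (auto simp: Suc.IH)
    then show "\<exists>us. length us = Suc k \<and> set us \<subseteq> {..n} \<and> Q (us @ g)"
      \<comment> \<open>The value chosen first ends up next to \<open>g\<close>, behind all values
        chosen later.\<close>
      by (intro exI[of _ "us @ [v]"]) auto
  next
    assume "\<exists>us. length us = Suc k \<and> set us \<subseteq> {..n} \<and> Q (us @ g)"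
    then obtain us where us: "length us = Suc k" "set us \<subseteq> {..n}" "Q (us @ g)" by blast
    then obtain vs v where "us = vs @ [v]" by (cases us rule: rev_cases) auto
    with us show "search Q n (Suc k) g"
      by (auto simp: Suc.IH)
  qed
qed simp

lemma find_item_nth: "find_item h a b = Some c \<Longrightarrow> h ! (c - b) = a"
proof (induction h arbitrary: b)
  case (Cons x h)
  show ?case
  proof (cases "x = a")
    case True
    with Cons.prems show ?thesis by simp
  next
    case False
    with Cons.prems have *: "find_item h a (Suc b) = Some c" by simp
    from find_item_SomeD[OF this] have "c - b = Suc (c - Suc b)" by linarith
    with Cons.IH[OF *] show ?thesis by simp
  qed
qed simp

lemma find_item_eq_None_iff: "find_item h a b = None \<longleftrightarrow> a \<notin> set h"
  by (induction h arbitrary: b) auto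

lemma assignment_find_item:
  assumes "length h = num_items G"
  shows "assignment G (\<lambda>a. find_item h a 0)"
proof -
  have "b < num_items G \<and> h ! b = a" if "find_item h a 0 = Some b" for a b
    using find_item_SomeD[OF that] find_item_nth[OF that] assms by simp
  then show ?thesis unfolding assignment_def by metis
qed

text \<open>Completeness of the search space. An agent of \<open>G\<close> has at most one item, so
  the first occurrence found by \<open>find_item\<close> is the right one; the values of
  \<open>p\<close> at other numbers are arbitrary and cannot be matched.\<close>

lemma ex_list_of_assignment:
  assumes "assignment G p"
  obtains h where "length h = num_items G" "set h \<subseteq> {..num_agents G}"
    "\<And>a. a < num_agents G \<Longrightarrow> find_item h a 0 = p a"
proof
  \<comment> \<open>An item has at most one recipient, which makes \<open>THE\<close> meaningful;
    unassigned items point to \<open>num_agents G\<close>, that is, to nobody.\<close>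
  define f where "f b = (if \<exists>a<num_agents G. p a = Some b
    then THE a. a < num_agents G \<and> p a = Some b else num_agents G)" for b
  have f: "f b = a" if "a < num_agents G" "p a = Some b" for a b
    using that assms unfolding f_def assignment_def by (auto intro!: the_equality)
  have f': "p (f b) = Some b" if "f b < num_agents G" for b
  proof -
    from that have "\<exists>a<num_agents G. p a = Some b"
      unfolding f_def by (auto split: if_splits)
    then show ?thesis using f by auto
  qed
  define h where "h = map f [0..<num_items G]"
  show "length h = num_items G" by (simp add: h_def)
  show "set h \<subseteq> {..num_agents G}"
  proof
    fix x assume "x \<in> set h"
    then obtain b where "x = f b" by (auto simp: h_def)
    moreover have "f b \<le> num_agents G"
    proof (cases "\<exists>a<num_agents G. p a = Some b")
      case True
      then show ?thesis using f by (metis less_imp_le)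
    next
      case False
      then have "\<not> (\<exists>a<num_agents G. p a = Some b)" by blast
      then show ?thesis unfolding f_def by (subst if_not_P) simp_all
    qed
    ultimately show "x \<in> {..num_agents G}" by simp
  qed
  fix a assume a: "a < num_agents G"
  show "find_item h a 0 = p a"
  proof (cases "find_item h a 0")
    case None
    have "p a = None"
    proof (rule ccontr)
      assume "p a \<noteq> None"
      then obtain b where b: "p a = Some b" by auto
      then have "b < num_items G" using assms a by (auto simp: assignment_def)
      then have "a \<in> set h" using f[OF a b] by (auto simp: h_def)
      with None show False by (simp add: find_item_eq_None_iff)
    qed
    with None show ?thesis by simp
  next
    case (Some c)
    then have "h ! c = a" "c < num_items G"
      using find_item_nth[of h a 0] find_item_SomeD[of h a 0] by (auto simp: h_def)
    then have "f c = a" by (simp add: h_def)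
    then have "p a = Some c" using f'[of c] a by simp
    with Some show ?thesis by simp
  qed
qed

lemma instanceD:
  assumes "goa_instance G" "j < num_layers G"
  shows "length (profiles G ! j) = num_agents G"
    and "a < num_agents G \<Longrightarrow> distinct (pref G j a)"
    and "a < num_agents G \<Longrightarrow> set (pref G j a) \<subseteq> {..<num_items G}"
proof -
  have *: "profiles G ! j \<in> set (profiles G)"
    using assms by (simp add: num_layers_def)
  then show "length (profiles G ! j) = num_agents G"
    using assms by (simp add: goa_instance_def)
  then have "pref G j a \<in> set (profiles G ! j)" if "a < num_agents G"
    using that by (simp add: pref_def)
  with * show "a < num_agents G \<Longrightarrow> distinct (pref G j a)"
    "a < num_agents G \<Longrightarrow> set (pref G j a) \<subseteq> {..<num_items G}"
    using assms by (auto simp: goa_instance_def)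
qed

lemma legal_iff:
  "legal G j p \<longleftrightarrow> assignment G p \<and> (\<forall>a<num_agents G. set_option (p a) \<subseteq> set (pref G j a))"
  unfolding legal_def by force

lemma legal_cong:
  assumes "\<And>a. a < num_agents G \<Longrightarrow> p a = q a"
  shows "legal G j p \<longleftrightarrow> legal G j q"
  using assms unfolding legal_def assignment_def by auto

lemma pareto_optimal_cong:
  assumes "\<And>a. a < num_agents G \<Longrightarrow> p a = q a"
  shows "pareto_optimal G j p \<longleftrightarrow> pareto_optimal G j q"
  using legal_cong[of G p q, OF assms] assms unfolding pareto_optimal_def by auto

lemma legal_iff_dominated:
  assumes G: "goa_instance G" "j < num_layers G" and h: "length h = num_items G"
  shows "legal G j (\<lambda>a. find_item h a 0) \<longleftrightarrow> dominated (profiles G ! j) 0 [] h"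
  using instanceD(1)[OF G] assignment_find_item[OF h]
  by (simp add: legal_iff dominated_iff scan_None pref_def)

lemma improves_iff:
  assumes G: "goa_instance G" "j < num_layers G"
    and h: "length h = num_items G" "legal G j (\<lambda>a. find_item h a 0)"
    and g: "length g = num_items G"
  shows "improves (num_agents G) (profiles G ! j) h g \<longleftrightarrow> legal G j (\<lambda>a. find_item g a 0) \<and>
    (\<forall>a<num_agents G. worse_eq (pref G j a) (find_item h a 0) (find_item g a 0)) \<and>
    (\<exists>a<num_agents G. worse (pref G j a) (find_item h a 0) (find_item g a 0))"
proof -
  have acc: "set_option (find_item h a 0) \<subseteq> set (pref G j a)" if "a < num_agents G" for a
    using h(2) that by (simp add: legal_iff)
  have dom: "dominated (profiles G ! j) 0 h g \<longleftrightarrow>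
      (\<forall>a<num_agents G. worse_eq (pref G j a) (find_item h a 0) (find_item g a 0))"
    unfolding dominated_iff instanceD(1)[OF G]
    using acc instanceD(2)[OF G] by (auto simp: scan_iff pref_def)
  have "legal G j (\<lambda>a. find_item g a 0)"
    if "\<forall>a<num_agents G. worse_eq (pref G j a) (find_item h a 0) (find_item g a 0)"
    using worse_eq_SomeD[OF instanceD(2)[OF G] acc] that assignment_find_item[OF g]
    by (simp add: legal_iff)
  moreover have "(\<exists>a<num_agents G. find_item h a 0 \<noteq> find_item g a 0) \<longleftrightarrow>
      (\<exists>a<num_agents G. worse (pref G j a) (find_item h a 0) (find_item g a 0))"
    if "\<forall>a<num_agents G. worse_eq (pref G j a) (find_item h a 0) (find_item g a 0)"
    using that worse_irrefl[OF instanceD(2)[OF G]] by (metis worse_eq_def)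
  ultimately show ?thesis
    unfolding improves_def dom by blast
qed

text \<open>Optimality depends on the values at agents only, and up to these every assignment is
  given by a list; so the quantifier over all functions becomes a finite search.\<close>

lemma po_list_iff:
  assumes G: "goa_instance G" "j < num_layers G" and h: "length h = num_items G"
  shows "po_list (num_agents G) (num_items G) (profiles G ! j) h \<longleftrightarrow>
    pareto_optimal G j (\<lambda>a. find_item h a 0)"
proof (cases "legal G j (\<lambda>a. find_item h a 0)")
  case True
  have "search (improves (num_agents G) (profiles G ! j) h) (num_agents G) (num_items G) [] \<longleftrightarrow>
    (\<exists>q. legal G j q \<and>
      (\<forall>a<num_agents G. worse_eq (pref G j a) (find_item h a 0) (q a)) \<and>
      (\<exists>a<num_agents G. worse (pref G j a) (find_item h a 0) (q a)))" (is "?L \<longleftrightarrow> ?R")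
  proof
    assume ?L
    then obtain g where "length g = num_items G" "improves (num_agents G) (profiles G ! j) h g"
      by (auto simp: search_iff)
    then show ?R using improves_iff[OF G h True] by blast
  next
    assume ?R
    then obtain q where q: "legal G j q"
      "\<forall>a<num_agents G. worse_eq (pref G j a) (find_item h a 0) (q a)"
      "\<exists>a<num_agents G. worse (pref G j a) (find_item h a 0) (q a)" by blast
    then have "assignment G q" by (simp add: legal_def)
    then obtain g where g: "length g = num_items G" "set g \<subseteq> {..num_agents G}"
      "\<And>a. a < num_agents G \<Longrightarrow> find_item g a 0 = q a" by (rule ex_list_of_assignment) blast
    then have "improves (num_agents G) (profiles G ! j) h g"
      unfolding improves_iff[OF G h True g(1)] using q legal_cong[of G _ q, OF g(3)] by auto
    with g show ?L by (auto simp: search_iff)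
  qed
  with True show ?thesis
    using legal_iff_dominated[OF G h] by (simp add: po_list_def pareto_optimal_def)
next
  case False
  then show ?thesis
    using legal_iff_dominated[OF G h] by (simp add: po_list_def pareto_optimal_def)
qed

text \<open>Replaces the choice of layers by a count, which the program can carry out.\<close>

lemma ex_subset_card_iff:
  assumes "finite A"
  shows "(\<exists>S. S \<subseteq> A \<and> card S = k \<and> (\<forall>j\<in>S. R j)) \<longleftrightarrow> k \<le> card {j \<in> A. R j}"
proof
  assume "\<exists>S. S \<subseteq> A \<and> card S = k \<and> (\<forall>j\<in>S. R j)"
  then obtain S where "S \<subseteq> {j \<in> A. R j}" "card S = k" by blast
  then show "k \<le> card {j \<in> A. R j}"
    using assms card_mono[of "{j \<in> A. R j}" S] by simp
next
  assume "k \<le> card {j \<in> A. R j}"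
  then obtain S where "S \<subseteq> {j \<in> A. R j}" "card S = k"
    by (rule obtain_subset_with_card_n) blast
  then show "\<exists>S. S \<subseteq> A \<and> card S = k \<and> (\<forall>j\<in>S. R j)" by blast
qed

lemma globally_optimal_iff:
  "globally_optimal G p \<longleftrightarrow> assignment G p \<and>
    threshold G \<le> card {j \<in> {..<num_layers G}. pareto_optimal G j p}"
  unfolding globally_optimal_def by (subst ex_subset_card_iff) simp_all

lemma solve_iff:
  assumes G: "goa_instance G"
  shows "solve G \<longleftrightarrow> has_globally_optimal_assignment G"
proof -
  have eq: "length (filter (\<lambda>P. po_list (num_agents G) (num_items G) P h) (profiles G)) =
    card {j \<in> {..<num_layers G}. pareto_optimal G j (\<lambda>a. find_item h a 0)}"
    if "length h = num_items G" for h
    unfolding length_filter_conv_card using po_list_iff[OF G _ that]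
    by (intro arg_cong[where f = card]) (auto simp: num_layers_def)
  show ?thesis
  proof
    assume "solve G"
    then obtain h where h: "length h = num_items G"
      "threshold G \<le> length (filter (\<lambda>P. po_list (num_agents G) (num_items G) P h) (profiles G))"
      by (auto simp: solve_def search_iff)
    then have "globally_optimal G (\<lambda>a. find_item h a 0)"
      using eq assignment_find_item by (simp add: globally_optimal_iff)
    then show "has_globally_optimal_assignment G"
      by (auto simp: has_globally_optimal_assignment_def)
  next
    assume "has_globally_optimal_assignment G"
    then obtain p where p: "globally_optimal G p"
      by (auto simp: has_globally_optimal_assignment_def)
    then have "assignment G p" by (simp add: globally_optimal_def)
    then obtain h where h: "length h = num_items G" "set h \<subseteq> {..num_agents G}"
      "\<And>a. a < num_agents G \<Longrightarrow> find_item h a 0 = p a" by (rule ex_list_of_assignment) blast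
    have "pareto_optimal G j (\<lambda>a. find_item h a 0) \<longleftrightarrow> pareto_optimal G j p" for j
      by (rule pareto_optimal_cong) (rule h(3))
    then show "solve G"
      using h(1,2) p eq[OF h(1)] by (auto simp: solve_def search_iff globally_optimal_iff)
  qed
qed

section \<open>Correctness of the reduction\<close>

definition legal_on :: "nat set \<Rightarrow> (nat \<Rightarrow> nat list) \<Rightarrow> (nat \<Rightarrow> nat option) \<Rightarrow> bool" where
  "legal_on A pr p \<longleftrightarrow> (\<forall>a\<in>A. set_option (p a) \<subseteq> set (pr a)) \<and>
     (\<forall>a\<in>A. \<forall>a'\<in>A. \<forall>b. p a = Some b \<and> p a' = Some b \<longrightarrow> a = a')"

definition improvement_on ::
  "nat set \<Rightarrow> (nat \<Rightarrow> nat list) \<Rightarrow> (nat \<Rightarrow> nat option) \<Rightarrow> (nat \<Rightarrow> nat option) \<Rightarrow> bool" where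
  "improvement_on A pr p q \<longleftrightarrow> legal_on A pr q \<and>
     (\<forall>a\<in>A. worse_eq (pr a) (p a) (q a)) \<and> (\<exists>a\<in>A. worse (pr a) (p a) (q a))"

text \<open>The reduced instance renumbers its agents. With this notion the exchange arguments can
  speak about the kept agents under their original numbers.\<close>

definition pareto_on :: "nat set \<Rightarrow> (nat \<Rightarrow> nat list) \<Rightarrow> (nat \<Rightarrow> nat option) \<Rightarrow> bool" where
  "pareto_on A pr p \<longleftrightarrow> legal_on A pr p \<and> (\<nexists>q. improvement_on A pr p q)"

lemma legal_iff_on:
  assumes "goa_instance G" "j < num_layers G"
  shows "legal G j p \<longleftrightarrow> legal_on {..<num_agents G} (pref G j) p"
  unfolding legal_iff legal_on_def assignment_def
  using instanceD(3)[OF assms] by fastforce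

lemma pareto_optimal_iff_on:
  assumes "goa_instance G" "j < num_layers G"
  shows "pareto_optimal G j p \<longleftrightarrow> pareto_on {..<num_agents G} (pref G j) p"
  unfolding pareto_optimal_def pareto_on_def improvement_on_def legal_iff_on[OF assms] by auto

lemma legal_on_reindex:
  assumes f: "bij_betw f A B"
  shows "legal_on A (\<lambda>a. pr (f a)) (\<lambda>a. p (f a)) \<longleftrightarrow> legal_on B pr p"
proof -
  have B: "B = f ` A" and inj: "inj_on f A" using f by (auto simp: bij_betw_def)
  show ?thesis unfolding legal_on_def B using inj by (auto simp: inj_on_eq_iff)
qed

lemma improvement_on_reindex:
  assumes f: "bij_betw f A B"
  shows "improvement_on A (\<lambda>a. pr (f a)) (\<lambda>a. p (f a)) (\<lambda>a. q (f a)) \<longleftrightarrow> improvement_on B pr p q"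
proof -
  have B: "B = f ` A" using f by (auto simp: bij_betw_def)
  show ?thesis
    unfolding improvement_on_def legal_on_reindex[OF f] by (auto simp: B)
qed

lemma improvement_on_cong:
  assumes "\<And>a. a \<in> A \<Longrightarrow> pr a = pr' a" "\<And>a. a \<in> A \<Longrightarrow> p a = p' a" "\<And>a. a \<in> A \<Longrightarrow> q a = q' a"
  shows "improvement_on A pr p q \<longleftrightarrow> improvement_on A pr' p' q'"
  unfolding improvement_on_def legal_on_def using assms by (auto simp: Ball_def)

lemma pareto_on_cong:
  assumes "\<And>a. a \<in> A \<Longrightarrow> pr a = pr' a" "\<And>a. a \<in> A \<Longrightarrow> p a = p' a"
  shows "pareto_on A pr p \<longleftrightarrow> pareto_on A pr' p'"
proof -
  have "legal_on A pr p \<longleftrightarrow> legal_on A pr' p'"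
    unfolding legal_on_def using assms by (auto simp: Ball_def)
  then show ?thesis
    unfolding pareto_on_def using improvement_on_cong[of A pr pr' p p'] assms by auto
qed

lemma pareto_on_reindex:
  assumes f: "bij_betw f A B"
  shows "pareto_on A (\<lambda>a. pr (f a)) (\<lambda>a. p (f a)) \<longleftrightarrow> pareto_on B pr p"
proof -
  have "(\<exists>q. improvement_on A (\<lambda>a. pr (f a)) (\<lambda>a. p (f a)) q) \<longleftrightarrow> (\<exists>q. improvement_on B pr p q)"
  proof
    assume "\<exists>q. improvement_on A (\<lambda>a. pr (f a)) (\<lambda>a. p (f a)) q"
    then obtain q where "improvement_on A (\<lambda>a. pr (f a)) (\<lambda>a. p (f a)) q" by blast
    \<comment> \<open>This brings an arbitrary \<open>q\<close> into the shape of a function of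
      \<open>f a\<close>, to which the reindexing applies.\<close>
    moreover have "q a = q (inv_into A f (f a))" if "a \<in> A" for a
      using f that by (simp add: bij_betw_def)
    ultimately have "improvement_on A (\<lambda>a. pr (f a)) (\<lambda>a. p (f a)) (\<lambda>a. q (inv_into A f (f a)))"
      using improvement_on_cong[of A "\<lambda>a. pr (f a)" _ "\<lambda>a. p (f a)" _ q "\<lambda>a. q (inv_into A f (f a))"]
      by simp
    then have "improvement_on B pr p (\<lambda>b. q (inv_into A f b))"
      by (simp add: improvement_on_reindex[OF f, symmetric])
    then show "\<exists>q. improvement_on B pr p q" by blast
  next
    assume "\<exists>q. improvement_on B pr p q"
    then show "\<exists>q. improvement_on A (\<lambda>a. pr (f a)) (\<lambda>a. p (f a)) q"
      unfolding improvement_on_reindex[OF f, symmetric] by blast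
  qed
  then show ?thesis
    unfolding pareto_on_def legal_on_reindex[OF f] by simp
qed

text \<open>An easy case of Hall's theorem: every candidate set is at least as large as the number
  of sets, so choosing greedily always leaves a fresh candidate.\<close>

lemma ex_system_of_representatives:
  assumes "finite X" "\<And>x. x \<in> X \<Longrightarrow> finite (C x)" "\<And>x. x \<in> X \<Longrightarrow> card X \<le> card (C x)"
  shows "\<exists>t. inj_on t X \<and> (\<forall>x\<in>X. t x \<in> C x)"
  using assms
proof (induction X)
  case (insert x X)
  have "card X \<le> card (C y)" if "y \<in> X" for y
    using insert.prems(2)[of y] insert.hyps that by simp
  with insert obtain t where t: "inj_on t X" "\<forall>y\<in>X. t y \<in> C y" by auto
  have "card (t ` X) < card (C x)"
    using insert.prems(2)[of x] insert.hyps by (simp add: card_image[OF t(1)])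
  then have "\<not> C x \<subseteq> t ` X"
    using insert.hyps by (meson card_mono finite_imageI leD)
  then obtain c where c: "c \<in> C x" "c \<notin> t ` X" by blast
  have "inj_on (t(x := c)) (insert x X)"
    using t(1) c insert.hyps by (auto simp: inj_on_def)
  moreover have "\<forall>y\<in>insert x X. (t(x := c)) y \<in> C y"
    using t(2) c insert.hyps by auto
  ultimately show ?case by blast
qed simp

text \<open>Applied with k = m + 1 to the earlier members of a large class. Inserting the maximum
  leaves the ranks of all other elements unchanged.\<close>

lemma card_low_rank:
  fixes X :: "nat set"
  assumes "finite X" "k \<le> card X"
  shows "k \<le> card {x \<in> X. card {y \<in> X. y < x} < k}"
  using assms
proof (induction X rule: finite_linorder_max_induct)
  case (insert b X)
  show ?case
  proof (cases "k \<le> card X")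
    case True
    have "{y \<in> insert b X. y < x} = {y \<in> X. y < x}" if "x \<in> X" for x
      using insert.hyps(2) that by auto
    then have "{x \<in> X. card {y \<in> X. y < x} < k} \<subseteq>
        {x \<in> insert b X. card {y \<in> insert b X. y < x} < k}" by auto
    from card_mono[OF _ this] insert.IH[OF True] insert.hyps(1) show ?thesis by simp
  next
    case False
    have "card {y \<in> insert b X. y < x} < k" if "x \<in> insert b X" for x
    proof -
      have "{y \<in> insert b X. y < x} \<subset> insert b X" using that by auto
      then have "card {y \<in> insert b X. y < x} < card (insert b X)"
        using insert.hyps(1) by (intro psubset_card_mono) auto
      moreover have "card (insert b X) \<le> Suc (card X)" by (rule card_insert_le_m1) auto
      ultimately show ?thesis using False by simp
    qed
    then have "{x \<in> insert b X. card {y \<in> insert b X. y < x} < k} = insert b X" by blast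
    with insert.prems show ?thesis by simp
  qed
qed simp

text \<open>One \<open>p'\<close> has to work for all layers of \<open>S\<close>. The classes refer
  to the set \<open>L\<close> of all layers because the reduction does not know
  \<open>S\<close>.\<close>

lemma pareto_on_subset:
  fixes pr :: "nat \<Rightarrow> nat \<Rightarrow> nat list"
  assumes A: "finite A" "K \<subseteq> A" and S: "S \<subseteq> L" "S \<noteq> {}"
    and dist: "\<And>j a. j \<in> S \<Longrightarrow> a \<in> A \<Longrightarrow> distinct (pr j a)"
    and items: "\<And>j a. j \<in> S \<Longrightarrow> a \<in> A \<Longrightarrow> set (pr j a) \<subseteq> {..<m}"
    and many: "\<And>a b. a \<in> A - K \<Longrightarrow> b < m \<Longrightarrow>
      m < card {k \<in> K. \<forall>j\<in>L. up b (pr j k) = up b (pr j a)}"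
    and opt: "\<And>j. j \<in> S \<Longrightarrow> pareto_on A (pr j) p"
  shows "\<exists>p'. \<forall>j\<in>S. pareto_on K (pr j) p'"
proof -
  \<comment> \<open>Legality in a single layer already bounds the number of item holders by
    \<open>m\<close>.\<close>
  obtain j0 where j0: "j0 \<in> S" using S by blast
  have legal: "legal_on A (pr j) p" if "j \<in> S" for j
    using opt[OF that] by (simp add: pareto_on_def)
  define H where "H = {a \<in> A. p a \<noteq> None}"
  have finH: "finite H" using A by (simp add: H_def)
  have item: "the (p a) < m" if "a \<in> H" for a
    using legal[OF j0] items[OF j0, of a] that unfolding H_def legal_on_def by fastforce
  have inj_p: "inj_on (\<lambda>a. the (p a)) H"
    using legal[OF j0] unfolding inj_on_def H_def legal_on_def by fastforce
  have "(\<lambda>a. the (p a)) ` H \<subseteq> {..<m}" using item by auto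
  from card_mono[OF finite_lessThan this] have cardH: "card H \<le> m"
    using card_image[OF inj_p] by simp
  define cls where "cls a = {k \<in> K. \<forall>j\<in>L. up (the (p a)) (pr j k) = up (the (p a)) (pr j a)}" for a
  define X where "X = H - K"
  have finK: "finite K" using A finite_subset by blast
  \<comment> \<open>The candidates are the kept class members that are idle under \<open>p\<close>.
    A class has more than \<open>m\<close> kept members and loses at most those in
    \<open>H \<inter> K\<close>; since \<open>card X + card (H \<inter> K)\<close> is at most
    \<open>m\<close>, more than \<open>card X\<close> of them remain.\<close>
  have "\<exists>t. inj_on t X \<and> (\<forall>x\<in>X. t x \<in> cls x - H)"
  proof (rule ex_system_of_representatives)
    show "finite X" using finH by (simp add: X_def)
    show "finite (cls x - H)" for x using finK by (simp add: cls_def)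
    fix x assume x: "x \<in> X"
    then have big: "m < card (cls x)"
      unfolding cls_def using item by (intro many) (auto simp: X_def H_def)
    have "card (cls x) \<le> card ((cls x - H) \<union> (H \<inter> K))"
      using finH finK by (intro card_mono) (auto simp: cls_def)
    also have "\<dots> \<le> card (cls x - H) + card (H \<inter> K)" by (rule card_Un_le)
    finally have "card (cls x) \<le> card (cls x - H) + card (H \<inter> K)" .
    moreover have "card H = card X + card (H \<inter> K)"
    proof -
      have "card (X \<union> (H \<inter> K)) = card X + card (H \<inter> K)"
        using finH by (intro card_Un_disjoint) (auto simp: X_def)
      moreover have "X \<union> (H \<inter> K) = H" by (auto simp: X_def)
      ultimately show ?thesis by simp
    qed
    ultimately show "card X \<le> card (cls x - H)" using big cardH by linarith
  qed
  then obtain t where t: "inj_on t X" "\<And>x. x \<in> X \<Longrightarrow> t x \<in> cls x - H" by blast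
  \<comment> \<open>\<open>\<tau> a\<close> takes over the item of \<open>a\<close>; \<open>p'\<close> is the resulting assignment on \<open>K\<close>, and an improvement
    \<open>q'\<close> of \<open>p'\<close> is pulled back along \<open>\<tau>\<close> to an improvement \<open>q\<close> of \<open>p\<close>.\<close>
  define \<tau> where "\<tau> a = (if a \<in> K then a else t a)" for a
  have \<tau>K: "\<tau> a \<in> K" if "a \<in> H" for a
    using that t(2)[of a] by (auto simp: \<tau>_def X_def cls_def)
  have \<tau>_sig: "up (the (p a)) (pr j (\<tau> a)) = up (the (p a)) (pr j a)" if "a \<in> H" "j \<in> S" for a j
    using that t(2)[of a] S by (auto simp: \<tau>_def X_def cls_def)
  \<comment> \<open>Substitutes are idle under \<open>p\<close>, so \<open>\<tau>\<close> reaches a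
    holder only by fixing it. Therefore no substitute collides with a kept holder.\<close>
  have \<tau>H: "\<tau> a = a" if "a \<in> H" "\<tau> a \<in> H" for a
    using that t(2)[of a] by (auto simp: \<tau>_def X_def split: if_splits)
  have inj_\<tau>: "inj_on \<tau> H"
  proof (rule inj_onI)
    fix a a' assume a: "a \<in> H" "a' \<in> H" "\<tau> a = \<tau> a'"
    show "a = a'"
    proof (cases "a \<in> K \<or> a' \<in> K")
      case True
      then have "\<tau> a \<in> H" using a by (auto simp: \<tau>_def)
      then show ?thesis using \<tau>H a by metis
    next
      case False
      then show ?thesis using a t(1) by (auto simp: \<tau>_def X_def inj_on_def)
    qed
  qed
  define p' where "p' k = (if k \<in> \<tau> ` H then p (inv_into H \<tau> k) else None)" for k
  have p'\<tau>: "p' (\<tau> a) = p a" if "a \<in> H" for a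
    using that inj_\<tau> by (simp add: p'_def)
  have p'None: "p' k = None" if "k \<notin> \<tau> ` H" for k
    using that by (simp add: p'_def)
  have acc: "the (p a) \<in> set (pr j a)" if "a \<in> H" "j \<in> S" for a j
    using legal[OF that(2)] that(1) by (auto simp: legal_on_def H_def)
  have acc': "the (p a) \<in> set (pr j (\<tau> a))" if "a \<in> H" "j \<in> S" for a j
    using up_self_mem[OF \<tau>_sig[OF that, symmetric] acc[OF that]] .
  have holder: "\<exists>a\<in>H. k = \<tau> a \<and> p a = Some b" if "p' k = Some b" for k b
    using that p'\<tau> p'None by (metis imageE option.distinct(1))
  have "pareto_on K (pr j) p'" if j: "j \<in> S" for j
    unfolding pareto_on_def
  proof (intro conjI notI)
    show "legal_on K (pr j) p'"
      unfolding legal_on_def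
    proof (intro conjI ballI allI impI subsetI)
      fix k b assume "k \<in> K" "b \<in> set_option (p' k)"
      then obtain a where "a \<in> H" "k = \<tau> a" "p a = Some b" using holder by force
      then show "b \<in> set (pr j k)" using acc'[OF _ j, of a] by simp
    next
      fix k k' b assume "p' k = Some b \<and> p' k' = Some b"
      then obtain a a' where "a \<in> H" "k = \<tau> a" "p a = Some b" "a' \<in> H" "k' = \<tau> a'" "p a' = Some b"
        using holder by metis
      then show "k = k'" using inj_onD[OF inj_p, of a a'] by simp
    qed
    assume "\<exists>q'. improvement_on K (pr j) p' q'"
    then obtain q' where q': "legal_on K (pr j) q'" "\<And>k. k \<in> K \<Longrightarrow> worse_eq (pr j k) (p' k) (q' k)"
      "\<exists>k\<in>K. worse (pr j k) (p' k) (q' k)" by (auto simp: improvement_on_def)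
    define q where "q a = (if a \<in> H then q' (\<tau> a) else if a \<in> K - \<tau> ` H then q' a else None)" for a
    \<comment> \<open>Here equivalence enters: measured against the same item, an agent and its
      substitute rate all outcomes alike.\<close>
    have up_iff: "worse_eq (pr j a) (p a) y \<longleftrightarrow> worse_eq (pr j (\<tau> a)) (p' (\<tau> a)) y"
      if a: "a \<in> H" for a y
    proof -
      have aA: "a \<in> A" "\<tau> a \<in> A" using a \<tau>K[OF a] A by (auto simp: H_def)
      have pa: "p a = Some (the (p a))" using a by (simp add: H_def)
      show ?thesis
        unfolding p'\<tau>[OF a]
        by (subst (1 2) pa)
          (simp add: worse_eq_up[OF dist[OF j aA(1)] acc[OF a j]]
            worse_eq_up[OF dist[OF j aA(2)] acc'[OF a j]] \<tau>_sig[OF a j])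
    qed
    have q_worse: "worse_eq (pr j a) (p a) (q a)" if a: "a \<in> A" for a
    proof (cases "a \<in> H")
      case True
      then show ?thesis using q'(2)[OF \<tau>K[OF True]] up_iff[OF True] by (simp add: q_def)
    next
      case False
      then have "p a = None" using a by (simp add: H_def)
      moreover have "worse_eq (pr j a) None (q' a)" if "a \<in> K - \<tau> ` H"
        using q'(2)[of a] p'None[of a] that by simp
      ultimately show ?thesis using False by (simp add: q_def worse_eq_def)
    qed
    have "legal_on A (pr j) q"
      unfolding legal_on_def
    proof (intro conjI ballI allI impI)
      fix a assume a: "a \<in> A"
      show "set_option (q a) \<subseteq> set (pr j a)"
        using worse_eq_SomeD[OF dist[OF j a] _ q_worse[OF a]] legal[OF j] a
        by (simp add: legal_on_def)
    next
      fix a a' b assume b: "q a = Some b \<and> q a' = Some b"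
      \<comment> \<open>\<open>\<sigma> a\<close> is the agent of \<open>K\<close> whose outcome
        under \<open>q'\<close> became \<open>q a\<close>. Holders are sent into the image of
        \<open>\<tau>\<close>, the others stay outside it, so legality of \<open>q'\<close>
        identifies the recipient.\<close>
      define \<sigma> where "\<sigma> a = (if a \<in> H then \<tau> a else a)" for a
      have \<sigma>: "\<sigma> a \<in> K \<and> q a = q' (\<sigma> a) \<and> (a \<notin> H \<longrightarrow> \<sigma> a \<notin> \<tau> ` H)" if "q a \<noteq> None" for a
        using that \<tau>K by (auto simp: q_def \<sigma>_def split: if_splits)
      have "q a \<noteq> None" "q a' \<noteq> None" using b by auto
      note \<sigma>a = \<sigma>[OF this(1)] \<sigma>[OF this(2)]
      from \<sigma>a b have "\<sigma> a \<in> K" "\<sigma> a' \<in> K"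
        "q' (\<sigma> a) = Some b" "q' (\<sigma> a') = Some b" by auto
      then have "\<sigma> a = \<sigma> a'"
        using q'(1) unfolding legal_on_def by blast
      then show "a = a'"
        using \<sigma>a inj_\<tau> by (cases "a \<in> H"; cases "a' \<in> H") (auto simp: \<sigma>_def inj_on_def)
    qed
    moreover have "\<exists>a\<in>A. worse (pr j a) (p a) (q a)"
    proof -
      obtain k where k: "k \<in> K" "worse (pr j k) (p' k) (q' k)" using q'(3) by blast
      \<comment> \<open>A difference is enough, since \<open>q_worse\<close> turns it into a strict
        gain.\<close>
      have "\<exists>a\<in>A. p a \<noteq> q a"
      proof (cases "k \<in> \<tau> ` H")
        case True
        then obtain a where a: "a \<in> H" "k = \<tau> a" by blast
        have "\<tau> a \<in> A" using \<tau>K[OF a(1)] A by blast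
        then have "p' k \<noteq> q' k" using k(2) a worse_irrefl[OF dist[OF j]] by metis
        then show ?thesis using a p'\<tau>[OF a(1)] by (auto simp: q_def H_def)
      next
        case False
        have kA: "k \<in> A" using k A by blast
        then have ne: "q' k \<noteq> None" using k(2) by (cases "q' k") auto
        \<comment> \<open>Kept holders are fixed by \<open>\<tau>\<close>, so an agent of
          \<open>K\<close> outside its image is idle under \<open>p\<close>.\<close>
        have "k \<notin> H" using False k(1) by (auto simp: \<tau>_def image_iff)
        then have "p k = None" "q k = q' k" using False k kA by (auto simp: H_def q_def)
        then show ?thesis using ne kA by metis
      qed
      then show ?thesis using q_worse by (metis worse_eq_def)
    qed
    ultimately have "improvement_on A (pr j) p q"
      using q_worse by (simp add: improvement_on_def)
    then show False using opt[OF j] by (auto simp: pareto_on_def)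
  qed
  then show ?thesis by blast
qed

text \<open>The deleted agents get nothing, whatever the layer, so the layers can be treated one at
  a time.\<close>

lemma pareto_on_superset:
  fixes pr :: "nat \<Rightarrow> nat list"
  assumes A: "finite A" "K \<subseteq> A"
    and dist: "\<And>a. a \<in> A \<Longrightarrow> distinct (pr a)"
    and items: "\<And>a. a \<in> A \<Longrightarrow> set (pr a) \<subseteq> {..<m}"
    and many: "\<And>a b. a \<in> A - K \<Longrightarrow> b < m \<Longrightarrow> m < card {k \<in> K. up b (pr k) = up b (pr a)}"
    and opt: "pareto_on K pr p"
  shows "pareto_on A pr (\<lambda>a. if a \<in> K then p a else None)"
proof -
  define p' where "p' a = (if a \<in> K then p a else None)" for a
  have legal: "legal_on K pr p" using opt by (simp add: pareto_on_def)
  have "legal_on A pr p'"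
    using legal A by (auto simp: legal_on_def p'_def split: if_splits)
  moreover have "\<not> improvement_on A pr p' q" for q
  proof
    assume "improvement_on A pr p' q"
    then have q: "legal_on A pr q" "\<And>a. a \<in> A \<Longrightarrow> worse_eq (pr a) (p' a) (q a)"
      "\<exists>a\<in>A. worse (pr a) (p' a) (q a)" by (auto simp: improvement_on_def)
    then obtain a where a: "a \<in> A" "worse (pr a) (p' a) (q a)" by blast
    have "\<not> improvement_on K pr p q" using opt by (simp add: pareto_on_def)
    moreover have "legal_on K pr q" using q(1) A(2) unfolding legal_on_def by (meson subsetD)
    moreover have "worse_eq (pr k) (p k) (q k)" if "k \<in> K" for k
      using q(2)[of k] that A(2) by (auto simp: p'_def)
    \<comment> \<open>Restricted to \<open>K\<close>, the improvement is legal and nowhere worse, so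
      optimality on \<open>K\<close> forces equality there and the gain goes to a deleted
      agent.\<close>
    ultimately have same: "q k = p k" if "k \<in> K" for k
      using that by (metis improvement_on_def worse_eq_def)
    have aK: "a \<notin> K"
      using a same worse_irrefl[OF dist[OF a(1)]] by (auto simp: p'_def)
    then obtain b where b: "q a = Some b"
      using a(2) by (cases "q a") (auto simp: p'_def)
    have "set_option (q a) \<subseteq> set (pr a)"
      using q(1) a(1) unfolding legal_on_def by blast
    with b have ba: "b \<in> set (pr a)" by simp
    then have bm: "b < m" using items[OF a(1)] by auto
    define Y where "Y = {k \<in> K. up b (pr k) = up b (pr a)}"
    have finK: "finite K" using A finite_subset by blast
    \<comment> \<open>Otherwise the more than \<open>m\<close> members of \<open>Y\<close> would
      hold distinct items below \<open>m\<close>.\<close>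
    have "\<exists>k\<in>Y. p k = None"
    proof (rule ccontr)
      assume "\<not> (\<exists>k\<in>Y. p k = None)"
      then have some: "p k = Some (the (p k))" if "k \<in> Y" for k using that by auto
      have "inj_on (\<lambda>k. the (p k)) Y"
        by (rule inj_onI) (use some legal in
          \<open>unfold legal_on_def Y_def, metis (no_types, lifting) mem_Collect_eq\<close>)
      moreover have "(\<lambda>k. the (p k)) ` Y \<subseteq> {..<m}"
      proof
        fix x assume "x \<in> (\<lambda>k. the (p k)) ` Y"
        then obtain k where k: "k \<in> Y" "x = the (p k)" by blast
        then have "k \<in> K" by (simp add: Y_def)
        then have "x \<in> set (pr k)"
          using legal some[OF k(1)] k(2)
          by (metis legal_on_def option.set_sel option.distinct(1) subsetD)
        then show "x \<in> {..<m}" using items[of k] \<open>k \<in> K\<close> A by blast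
      qed
      ultimately have "card Y \<le> m"
        using card_mono[of "{..<m}" "(\<lambda>k. the (p k)) ` Y"] by (simp add: card_image)
      moreover have "m < card Y" unfolding Y_def using many[of a b] a(1) aK bm by simp
      ultimately show False by simp
    qed
    then obtain k where k: "k \<in> K" "up b (pr k) = up b (pr a)" "p k = None" by (auto simp: Y_def)
    have bk: "b \<in> set (pr k)" using up_self_mem[OF k(2)[symmetric] ba] .
    have free: "p k' \<noteq> Some b" if "k' \<in> K" for k'
      using same[OF that] q(1) a(1) b aK that A(2) unfolding legal_on_def by (metis subsetD)
    have "improvement_on K pr p (p(k := Some b))"
      unfolding improvement_on_def
    proof (intro conjI)
      show "legal_on K pr (p(k := Some b))"
        using legal free bk unfolding legal_on_def by auto
      show "\<forall>a\<in>K. worse_eq (pr a) (p a) ((p(k := Some b)) a)"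
        using k bk by (auto simp: worse_eq_def)
      show "\<exists>a\<in>K. worse (pr a) (p a) ((p(k := Some b)) a)"
        using k bk by (intro bexI[of _ k]) auto
    qed
    then show False using opt by (auto simp: pareto_on_def)
  qed
  ultimately show ?thesis unfolding pareto_on_def p'_def by blast
qed

section \<open>Renumbering of the kept agents and transfer of optimality\<close>

lemma select_from_eq:
  "select_from K xs a = map (\<lambda>i. xs ! (i - a)) (filter K [a..<a + length xs])"
proof (induction xs arbitrary: a)
  case (Cons x xs)
  have *: "[a..<a + length (x # xs)] = a # [Suc a..<Suc a + length xs]"
    by (simp add: upt_rec)
  have "map (\<lambda>i. (x # xs) ! (i - a)) (filter K [Suc a..<Suc a + length xs]) =
      map (\<lambda>i. xs ! (i - Suc a)) (filter K [Suc a..<Suc a + length xs])"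
    by (rule map_cong) (auto simp: nth_Cons')
  then show ?case
    unfolding * by (simp add: Cons.IH)
qed simp

text \<open>Indexing into this list is the renumbering: its \<open>i\<close>-th entry is the
  original number of agent \<open>i\<close> of the reduced instance.\<close>

definition kept_agents :: "goa \<Rightarrow> nat list" where
  "kept_agents G = filter (kept (profiles G) (num_items G)) [0..<num_agents G]"

lemma set_kept_agents:
  "set (kept_agents G) = {a. a < num_agents G \<and> kept (profiles G) (num_items G) a}"
  by (auto simp: kept_agents_def)

lemma distinct_kept_agents: "distinct (kept_agents G)"
  by (simp add: kept_agents_def)

lemma num_agents_reduce: "num_agents (reduce G) = length (kept_agents G)"
  unfolding distinct_card[OF distinct_kept_agents, symmetric] set_kept_agents
  by (simp add: reduce_def)

lemma reduce_simps [simp]: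
  "num_items (reduce G) = num_items G"
  "threshold (reduce G) = threshold G"
  "num_layers (reduce G) = num_layers G"
  by (simp_all add: reduce_def num_layers_def)

lemma profiles_reduce:
  assumes "goa_instance G" "j < num_layers G"
  shows "profiles (reduce G) ! j = map ((!) (profiles G ! j)) (kept_agents G)"
  using instanceD(1)[OF assms] assms(2)
  by (simp add: reduce_def select_from_eq kept_agents_def num_layers_def)

lemma pref_reduce:
  assumes "goa_instance G" "j < num_layers G" "i < length (kept_agents G)"
  shows "pref (reduce G) j i = pref G j (kept_agents G ! i)"
  using profiles_reduce[OF assms(1,2)] assms(3) by (simp add: pref_def)

lemma instance_reduce:
  assumes G: "goa_instance G"
  shows "goa_instance (reduce G)"
  unfolding goa_instance_def
proof (intro conjI ballI)
  fix P assume "P \<in> set (profiles (reduce G))"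
  then obtain j where j: "j < num_layers G" "P = profiles (reduce G) ! j"
    by (metis in_set_conv_nth num_layers_def reduce_simps(3))
  then have P: "P = map ((!) (profiles G ! j)) (kept_agents G)"
    using profiles_reduce[OF G] by simp
  then show "length P = num_agents (reduce G)" by (simp add: num_agents_reduce)
  fix L assume "L \<in> set P"
  then obtain a where "a < num_agents G" "L = pref G j a"
    by (auto simp: P set_kept_agents pref_def)
  then show "distinct L" "set L \<subseteq> {..<num_items (reduce G)}"
    using instanceD(2,3)[OF G j(1)] by auto
next
  show "1 \<le> threshold (reduce G)" "threshold (reduce G) \<le> num_layers (reduce G)"
    using G by (auto simp: goa_instance_def)
qed

lemma sig_eq_iff:
  "sig (profiles G) a b = sig (profiles G) a' b \<longleftrightarrow>
    (\<forall>j<num_layers G. up b (pref G j a) = up b (pref G j a'))"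
  by (simp add: sig_def all_set_conv_all_nth num_layers_def pref_def)

text \<open>A deleted agent has, for each \<open>b\<close>, more than \<open>m\<close> equivalent
  predecessors. The first m + 1 of these have at most \<open>m\<close> equivalent predecessors
  themselves and are therefore kept.\<close>

lemma card_kept_same_sig:
  assumes a: "a \<in> {..<num_agents G} - set (kept_agents G)" and b: "b < num_items G"
  shows "num_items G < card {k \<in> set (kept_agents G).
    \<forall>j\<in>{..<num_layers G}. up b (pref G j k) = up b (pref G j a)}"
proof -
  let ?sig = "\<lambda>a. sig (profiles G) a b" and ?m = "num_items G"
  define X where "X = {i. i < a \<and> ?sig i = ?sig a}"
  have "\<not> few_before (profiles G) ?m a b"
    using a b by (auto simp: set_kept_agents kept_def)
  then have "Suc ?m \<le> card X" by (simp add: few_before_def X_def)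
  then have "Suc ?m \<le> card {x \<in> X. card {y \<in> X. y < x} < Suc ?m}"
    by (intro card_low_rank) (simp_all add: X_def)
  also have "\<dots> \<le> card {k \<in> set (kept_agents G).
    \<forall>j\<in>{..<num_layers G}. up b (pref G j k) = up b (pref G j a)}"
  proof (intro card_mono subsetI)
    fix x assume "x \<in> {x \<in> X. card {y \<in> X. y < x} < Suc ?m}"
    then have x: "x < a" "?sig x = ?sig a" "card {y \<in> X. y < x} \<le> ?m" by (auto simp: X_def)
    moreover have "{y \<in> X. y < x} = {i. i < x \<and> ?sig i = ?sig x}"
      using x by (auto simp: X_def)
    ultimately have "few_before (profiles G) ?m x b" by (simp add: few_before_def)
    then have "x \<in> set (kept_agents G)"
      using a b x(1) by (auto simp: set_kept_agents kept_def)
    with x(2) show "x \<in> {k \<in> set (kept_agents G).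
      \<forall>j\<in>{..<num_layers G}. up b (pref G j k) = up b (pref G j a)}"
      by (simp add: sig_eq_iff)
  qed simp
  finally show ?thesis by simp
qed

lemma reduce_iff:
  assumes G: "goa_instance G"
  shows "has_globally_optimal_assignment (reduce G) \<longleftrightarrow> has_globally_optimal_assignment G"
proof -
  let ?A = "{..<num_agents G}" and ?B = "{..<num_agents (reduce G)}"
    and ?K = "set (kept_agents G)" and ?f = "(!) (kept_agents G)"
  have bij: "bij_betw ?f ?B ?K"
    by (rule bij_betw_nth) (simp_all add: distinct_kept_agents num_agents_reduce)
  have KA: "?K \<subseteq> ?A" by (auto simp: set_kept_agents)
  have reduced: "pareto_optimal (reduce G) j p \<longleftrightarrow> pareto_on ?B (\<lambda>i. pref G j (?f i)) p"
    if "j < num_layers G" for j p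
    using that pref_reduce[OF G that]
    by (subst pareto_optimal_iff_on[OF instance_reduce[OF G]])
      (auto intro!: pareto_on_cong simp: num_agents_reduce)
  have assignment: "assignment H p" if "pareto_optimal H j p" for H j p
    using that by (simp add: pareto_optimal_def legal_def)
  have thr: "1 \<le> threshold G" using G by (simp add: goa_instance_def)
  show ?thesis
  proof
    assume "has_globally_optimal_assignment G"
    then obtain p S where S: "S \<subseteq> {..<num_layers G}" "card S = threshold G"
      and p: "\<And>j. j \<in> S \<Longrightarrow> pareto_optimal G j p"
      by (auto simp: has_globally_optimal_assignment_def globally_optimal_def)
    have "S \<noteq> {}" using S(2) thr by auto
    have "\<exists>p'. \<forall>j\<in>S. pareto_on ?K (pref G j) p'"
    proof (rule pareto_on_subset[OF _ KA S(1) \<open>S \<noteq> {}\<close>, where m = "num_items G"])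
      show "pareto_on ?A (pref G j) p" if "j \<in> S" for j
        using p[OF that] that S(1) pareto_optimal_iff_on[OF G] by auto
      show "num_items G < card {k \<in> ?K. \<forall>j\<in>{..<num_layers G}. up b (pref G j k) = up b (pref G j a)}"
        if "a \<in> ?A - ?K" "b < num_items G" for a b
        using that by (rule card_kept_same_sig)
      fix j a assume "j \<in> S" "a \<in> ?A"
      with S(1) have "j < num_layers G" "a < num_agents G" by auto
      then show "distinct (pref G j a)" "set (pref G j a) \<subseteq> {..<num_items G}"
        using instanceD(2,3)[OF G] by blast+
    qed simp
    then obtain p' where p': "\<And>j. j \<in> S \<Longrightarrow> pareto_on ?K (pref G j) p'" by blast
    have "pareto_optimal (reduce G) j (\<lambda>i. p' (?f i))" if "j \<in> S" for j
      using p'[OF that] pareto_on_reindex[OF bij, of "pref G j" p'] reduced that S(1) by auto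
    then have "globally_optimal (reduce G) (\<lambda>i. p' (?f i))"
      using S assignment \<open>S \<noteq> {}\<close> by (fastforce simp: globally_optimal_def)
    then show "has_globally_optimal_assignment (reduce G)"
      by (auto simp: has_globally_optimal_assignment_def)
  next
    assume "has_globally_optimal_assignment (reduce G)"
    then obtain p S where S: "S \<subseteq> {..<num_layers G}" "card S = threshold G"
      and p: "\<And>j. j \<in> S \<Longrightarrow> pareto_optimal (reduce G) j p"
      by (auto simp: has_globally_optimal_assignment_def globally_optimal_def)
    have "S \<noteq> {}" using S(2) thr by auto
    define p' where "p' k = p (inv_into ?B ?f k)" for k
    define p'' where "p'' a = (if a \<in> ?K then p' a else None)" for a
    have "pareto_optimal G j p''" if j: "j \<in> S" for j
    proof -
      have jl: "j < num_layers G" using j S(1) by auto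
      have "pareto_on ?B (\<lambda>i. pref G j (?f i)) p" using p[OF j] reduced[OF jl] by simp
      also have "?this \<longleftrightarrow> pareto_on ?B (\<lambda>i. pref G j (?f i)) (\<lambda>i. p' (?f i))"
        using bij by (intro pareto_on_cong) (simp_all add: p'_def bij_betw_def)
      also have "\<dots> \<longleftrightarrow> pareto_on ?K (pref G j) p'" by (rule pareto_on_reindex[OF bij])
      finally have "pareto_on ?A (pref G j) p''"
        unfolding p''_def
      proof (rule pareto_on_superset[OF _ KA, rotated -1])
        fix a b assume a: "a \<in> ?A - ?K" and b: "b < num_items G"
        have "{k \<in> ?K. \<forall>j\<in>{..<num_layers G}. up b (pref G j k) = up b (pref G j a)} \<subseteq>
            {k \<in> ?K. up b (pref G j k) = up b (pref G j a)}" using jl by auto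
        from card_mono[OF _ this] card_kept_same_sig[OF a b]
        show "num_items G < card {k \<in> ?K. up b (pref G j k) = up b (pref G j a)}" by simp
      next
        fix a assume "a \<in> ?A"
        then show "distinct (pref G j a)" "set (pref G j a) \<subseteq> {..<num_items G}"
          using instanceD(2,3)[OF G jl] by auto
      qed simp
      then show ?thesis using pareto_optimal_iff_on[OF G jl] by simp
    qed
    then have "globally_optimal G p''"
      using S assignment \<open>S \<noteq> {}\<close> by (fastforce simp: globally_optimal_def)
    then show "has_globally_optimal_assignment G"
      by (auto simp: has_globally_optimal_assignment_def)
  qed
qed

section \<open>Size of the reduced instance\<close>

definition distinct_lists :: "nat set \<Rightarrow> nat list set" where
  "distinct_lists X = {xs. distinct xs \<and> set xs \<subseteq> X}"

lemma finite_distinct_lists: "finite X \<Longrightarrow> finite (distinct_lists X)"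
  unfolding distinct_lists_def
  by (rule finite_subset[OF _ finite_lists_length_le[of X "card X"]])
    (auto simp: distinct_card[symmetric] intro!: card_mono)

text \<open>Without the summand 1 the induction would not go through.\<close>

lemma card_distinct_lists_le:
  assumes "finite X" "card X = k"
  shows "card (distinct_lists X) + (if k = 0 then 0 else 1) \<le> 3 * fact k"
  using assms
proof (induction k arbitrary: X)
  case 0
  then have "distinct_lists X = {[]}" by (auto simp: distinct_lists_def)
  then show ?case by simp
next
  case (Suc k)
  \<comment> \<open>Splitting off the first entry gives the recursion a(k+1) = 1 + (k+1) a(k), whose
    solution is at most e k!.\<close>
  have "distinct_lists X \<subseteq> {[]} \<union> (\<Union>x\<in>X. (#) x ` distinct_lists (X - {x}))"
  proof
    fix xs assume "xs \<in> distinct_lists X"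
    then show "xs \<in> {[]} \<union> (\<Union>x\<in>X. (#) x ` distinct_lists (X - {x}))"
      by (cases xs) (auto simp: distinct_lists_def)
  qed
  then have "card (distinct_lists X) \<le> card ({[]} \<union> (\<Union>x\<in>X. (#) x ` distinct_lists (X - {x})))"
    using Suc.prems by (intro card_mono) (auto intro!: finite_distinct_lists)
  also have "\<dots> \<le> 1 + card (\<Union>x\<in>X. (#) x ` distinct_lists (X - {x}))"
    by (rule order_trans[OF card_Un_le]) simp
  also have "card (\<Union>x\<in>X. (#) x ` distinct_lists (X - {x})) \<le>
      (\<Sum>x\<in>X. card ((#) x ` distinct_lists (X - {x})))"
    using Suc.prems by (intro card_UN_le) simp
  also have "\<dots> \<le> (\<Sum>x\<in>X. if k = 0 then 1 else 3 * fact k - 1)"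
  proof (rule sum_mono)
    fix x assume x: "x \<in> X"
    have "card ((#) x ` distinct_lists (X - {x})) = card (distinct_lists (X - {x}))"
      by (rule card_image) simp
    moreover have "card (distinct_lists (X - {x})) + (if k = 0 then 0 else 1) \<le> 3 * fact k"
      using Suc x by (intro Suc.IH) auto
    moreover have "card (distinct_lists (X - {x})) = 1" if "k = 0"
    proof -
      have "X - {x} = {}" using Suc.prems x that card_0_eq[of "X - {x}"] by simp
      have "distinct_lists (X - {x}) = {[]}"
        unfolding \<open>X - {x} = {}\<close> by (auto simp: distinct_lists_def)
      then show ?thesis by simp
    qed
    ultimately show "card ((#) x ` distinct_lists (X - {x})) \<le> (if k = 0 then 1 else 3 * fact k - 1)"
      by (auto split: if_splits)
  qed
  also have "\<dots> = Suc k * (if k = 0 then 1 else 3 * fact k - 1)" using Suc.prems by simp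
  finally have *: "card (distinct_lists X) \<le> 1 + Suc k * (if k = 0 then 1 else 3 * fact k - 1)"
    by simp
  show ?case
  \<comment> \<open>The induction hypothesis saves one unit for each possible first entry. Two units
    pay for the empty list and the extra summand, so there must be at least two first entries; the
    step from 0 to 1 uses the exact count instead.\<close>
  proof (cases "k = 0")
    case True
    with * show ?thesis by simp
  next
    case False
    have "0 < (3 * fact k :: nat)" by simp
    then obtain z where z: "3 * fact k = Suc z" using gr0_implies_Suc by blast
    then have "Suc k * (3 * fact k - 1) + Suc k = Suc k * (3 * fact k)" by simp
    also have "\<dots> = 3 * fact (Suc k)" by simp
    finally show ?thesis using * False by simp
  qed
qed

lemma up_eq: "up b L = (if b \<in> set L then takeWhile (\<lambda>x. x \<noteq> b) L @ [b] else L)"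
  by (induction L) auto

text \<open>The gain over counting whole lists: apart from a final \<open>b\<close>, the entries
  come from only m - 1 items. Having or lacking that final \<open>b\<close> doubles the bound
  \<open>3 * fact (m - 1)\<close>.\<close>

lemma card_up_le:
  assumes "b < m"
  shows "finite (up b ` distinct_lists {..<m})"
    and "card (up b ` distinct_lists {..<m}) \<le> 6 * fact (m - 1)"
proof -
  let ?D = "distinct_lists ({..<m} - {b})"
  have fin: "finite ?D" by (simp add: finite_distinct_lists)
  have sub: "up b ` distinct_lists {..<m} \<subseteq> ?D \<union> (\<lambda>xs. xs @ [b]) ` ?D"
  proof
    fix y assume "y \<in> up b ` distinct_lists {..<m}"
    then obtain L where L: "distinct L" "set L \<subseteq> {..<m}" "y = up b L"
      by (auto simp: distinct_lists_def)
    show "y \<in> ?D \<union> (\<lambda>xs. xs @ [b]) ` ?D"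
    proof (cases "b \<in> set L")
      case True
      have "takeWhile (\<lambda>x. x \<noteq> b) L \<in> ?D"
        using L by (auto simp: distinct_lists_def dest: set_takeWhileD)
      with True L show ?thesis by (simp add: up_eq)
    next
      case False
      with L show ?thesis by (auto simp: up_eq distinct_lists_def)
    qed
  qed
  from fin sub show "finite (up b ` distinct_lists {..<m})"
    by (meson finite_UnI finite_imageI finite_subset)
  have "card (up b ` distinct_lists {..<m}) \<le> card (?D \<union> (\<lambda>xs. xs @ [b]) ` ?D)"
    using fin sub by (intro card_mono) auto
  also have "\<dots> \<le> card ?D + card ((\<lambda>xs. xs @ [b]) ` ?D)" by (rule card_Un_le)
  also have "\<dots> \<le> card ?D + card ?D" using fin by (intro add_left_mono card_image_le)
  also have "card ?D \<le> 3 * fact (m - 1)"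
    using card_distinct_lists_le[of "{..<m} - {b}" "m - 1"] assms by simp
  finally show "card (up b ` distinct_lists {..<m}) \<le> 6 * fact (m - 1)" by simp
qed

text \<open>An agent kept on account of \<open>b\<close> is determined by its signature and its rank
  in its class, because ranks grow strictly within a class; the rank is one of the m + 1 numbers up
  to \<open>m\<close>.\<close>

lemma num_agents_reduce_le:
  assumes G: "goa_instance G"
  defines "m \<equiv> num_items G"
  shows "num_agents (reduce G) \<le> m * ((6 * fact (m - 1)) ^ num_layers G * (m + 1))"
proof -
  let ?few = "\<lambda>b. {a. a < num_agents G \<and> few_before (profiles G) m a b}"
  let ?Sigs = "\<lambda>b. {xs. set xs \<subseteq> up b ` distinct_lists {..<m} \<and> length xs = num_layers G}"
  have few: "card (?few b) \<le> (6 * fact (m - 1)) ^ num_layers G * (m + 1)" if b: "b < m" for b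
  proof -
    define rank where "rank a = card {i. i < a \<and> sig (profiles G) i b = sig (profiles G) a b}" for a
    have fin: "finite (?Sigs b \<times> {..m})"
      using finite_lists_length_eq[OF card_up_le(1)[OF b]] by simp
    have inj: "inj_on (\<lambda>a. (sig (profiles G) a b, rank a)) (?few b)"
    proof (rule linorder_inj_onI)
      fix a a' :: nat assume less: "a < a'"
      show "(sig (profiles G) a b, rank a) \<noteq> (sig (profiles G) a' b, rank a')"
      proof
        assume "(sig (profiles G) a b, rank a) = (sig (profiles G) a' b, rank a')"
        then have eq: "sig (profiles G) a b = sig (profiles G) a' b" "rank a = rank a'" by auto
        then have "{i. i < a \<and> sig (profiles G) i b = sig (profiles G) a b} \<subset>
          {i. i < a' \<and> sig (profiles G) i b = sig (profiles G) a' b}" using less by auto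
        then have "rank a < rank a'" unfolding rank_def by (intro psubset_card_mono) auto
        with eq show False by simp
      qed
    qed auto
    have sub: "(\<lambda>a. (sig (profiles G) a b, rank a)) ` ?few b \<subseteq> ?Sigs b \<times> {..m}"
    proof (intro image_subsetI)
      fix a assume a: "a \<in> ?few b"
      have "P ! a \<in> distinct_lists {..<m}" if "P \<in> set (profiles G)" for P
        using that a G by (auto simp: goa_instance_def distinct_lists_def m_def)
      then show "(sig (profiles G) a b, rank a) \<in> ?Sigs b \<times> {..m}"
        using a by (auto simp: sig_def num_layers_def few_before_def rank_def)
    qed
    have "card (?few b) \<le> card (?Sigs b \<times> {..m})"
      using card_mono[OF fin sub] by (simp only: card_image[OF inj])
    also have "\<dots> = card (up b ` distinct_lists {..<m}) ^ num_layers G * (m + 1)"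
      by (simp add: card_cartesian_product card_lists_length_eq[OF card_up_le(1)[OF b]])
    also have "\<dots> \<le> (6 * fact (m - 1)) ^ num_layers G * (m + 1)"
      using card_up_le(2)[OF b] by (intro mult_right_mono power_mono) auto
    finally show ?thesis .
  qed
  have "num_agents (reduce G) = card (\<Union>b\<in>{..<m}. ?few b)"
    unfolding reduce_def kept_def m_def by (auto intro!: arg_cong[where f = card])
  also have "\<dots> \<le> (\<Sum>b<m. card (?few b))" by (rule card_UN_le) simp
  also have "\<dots> \<le> (\<Sum>b<m. (6 * fact (m - 1)) ^ num_layers G * (m + 1))"
    by (intro sum_mono few) simp
  finally show ?thesis by simp
qed

section \<open>Kernel and fixed-parameter tractability\<close>

definition poly_bounded :: "(nat \<Rightarrow> nat) \<Rightarrow> bool" where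
  "poly_bounded T \<longleftrightarrow> (\<exists>c. \<forall>N\<ge>1. T N \<le> c * N ^ c)"

text \<open>From N = 1 on, raising the coefficient or the exponent only enlarges the bound, so their
  sum can serve as both.\<close>

lemma poly_boundedI:
  assumes "\<And>N. 1 \<le> N \<Longrightarrow> T N \<le> c * N ^ d"
  shows "poly_bounded T"
  unfolding poly_bounded_def
proof (intro exI allI impI)
  fix N :: nat assume "1 \<le> N"
  then have "c * N ^ d \<le> (c + d) * N ^ (c + d)"
    by (intro mult_le_mono power_increasing) auto
  with assms[OF \<open>1 \<le> N\<close>] show "T N \<le> (c + d) * N ^ (c + d)" by (rule order_trans)
qed

lemma poly_bounded_const: "poly_bounded (\<lambda>_. k)"
  by (rule poly_boundedI[of _ k 0]) simp

lemma poly_bounded_id: "poly_bounded (\<lambda>N. N)"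
  by (rule poly_boundedI[of _ 1 1]) simp

lemma poly_bounded_add:
  assumes "poly_bounded S" "poly_bounded T"
  shows "poly_bounded (\<lambda>N. S N + T N)"
proof -
  obtain c d where "\<And>N. 1 \<le> N \<Longrightarrow> S N \<le> c * N ^ c" "\<And>N. 1 \<le> N \<Longrightarrow> T N \<le> d * N ^ d"
    using assms by (auto simp: poly_bounded_def)
  note bounds = this
  show ?thesis
  proof (rule poly_boundedI)
    fix N :: nat assume N: "1 \<le> N"
    have "c * N ^ c \<le> c * N ^ (c + d)" "d * N ^ d \<le> d * N ^ (c + d)"
      by (intro mult_le_mono2 power_increasing N; simp)+
    with bounds[OF N] show "S N + T N \<le> (c + d) * N ^ (c + d)"
      unfolding distrib_right by linarith
  qed
qed

lemma poly_bounded_mult: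
  assumes "poly_bounded S" "poly_bounded T"
  shows "poly_bounded (\<lambda>N. S N * T N)"
proof -
  obtain c d where "\<And>N. 1 \<le> N \<Longrightarrow> S N \<le> c * N ^ c" "\<And>N. 1 \<le> N \<Longrightarrow> T N \<le> d * N ^ d"
    using assms by (auto simp: poly_bounded_def)
  note bounds = this
  show ?thesis
  proof (rule poly_boundedI)
    fix N :: nat assume N: "1 \<le> N"
    have "S N * T N \<le> (c * N ^ c) * (d * N ^ d)"
      using bounds[OF N] by (rule mult_le_mono)
    also have "\<dots> = (c * d) * N ^ (c + d)" by (simp add: power_add)
    finally show "S N * T N \<le> (c * d) * N ^ (c + d)" .
  qed
qed

lemma poly_bounded_power: "poly_bounded S \<Longrightarrow> poly_bounded (\<lambda>N. S N ^ k)"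
  by (induction k) (simp_all add: poly_bounded_const poly_bounded_mult)

lemmas poly_bounded_intros =
  poly_bounded_const poly_bounded_id poly_bounded_add poly_bounded_mult poly_bounded_power

text \<open>The extra \<open>K\<close> closes the induction: the recursion multiplies just this sum
  by n + 1.\<close>

lemma search_time_le: "search_time K n k + K \<le> K * (n + 2) ^ Suc k"
proof (induction k)
  case (Suc k)
  have "search_time K n (Suc k) + K = (n + 1) * (search_time K n k + K) + K"
    by (simp add: add.commute)
  also have "\<dots> \<le> (n + 1) * (K * (n + 2) ^ Suc k) + K * (n + 2) ^ Suc k"
    by (intro add_mono mult_le_mono2 Suc.IH) (simp_all add: Suc_leI)
  also have "\<dots> = K * (n + 2) ^ Suc (Suc k)" by (simp add: algebra_simps)
  finally show ?case .
qed simp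

definition solve_factor :: "nat \<Rightarrow> nat" where
  "solve_factor N = (N + 1) * (dominated_time N + leaf_time N + 60) + 80"

text \<open>Two nested searches, through the candidates and through their possible improvements,
  contribute a factor \<open>W\<close> each. What is left is a polynomial in \<open>N\<close>, so
  only the power of n + 2 has to be controlled by the number of items.\<close>

lemma solve_time_le: "solve_time N n m \<le> solve_factor N * (n + 2) ^ (2 * m + 2)"
proof -
  define W where "W = (n + 2) ^ Suc m"
  have W: "1 \<le> W" by (simp add: W_def Suc_leI)
  have "search_time (leaf_time N) n m \<le> leaf_time N * W"
    using search_time_le[of "leaf_time N" n m] by (simp add: W_def)
  then have "dominated_time N + search_time (leaf_time N) n m + 60 \<le>
      dominated_time N * W + leaf_time N * W + 60 * W"
    using W by (intro add_mono) auto
  then have "count_time N n m \<le> (N + 1) * ((dominated_time N + leaf_time N + 60) * W)"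
    unfolding count_time_def by (intro mult_le_mono2) (simp add: distrib_right)
  also have "\<dots> = ((N + 1) * (dominated_time N + leaf_time N + 60)) * W" by (simp only: mult.assoc)
  finally have "count_time N n m + 60 \<le> ((N + 1) * (dominated_time N + leaf_time N + 60)) * W + 60 * W"
    using W by (intro add_mono) auto
  then have K: "count_time N n m + 60 \<le> ((N + 1) * (dominated_time N + leaf_time N + 60) + 60) * W"
    by (simp only: distrib_right)
  have "solve_time N n m \<le> (count_time N n m + 60) * W + 20"
    using search_time_le[of "count_time N n m + 60" n m] by (simp add: solve_time_def W_def)
  also have "\<dots> \<le> ((N + 1) * (dominated_time N + leaf_time N + 60) + 60) * W * W + 20 * (W * W)"
    using K W by (intro add_mono mult_le_mono) auto
  also have "\<dots> = solve_factor N * (W * W)" by (simp add: solve_factor_def algebra_simps)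
  also have "W * W = (n + 2) ^ (Suc m + Suc m)" by (simp only: W_def power_add)
  also have "Suc m + Suc m = 2 * m + 2" by simp
  finally show ?thesis .
qed

lemma poly_bounded_solve_factor: "poly_bounded solve_factor"
  unfolding solve_factor_def[abs_def] dominated_time_def leaf_time_def differ_time_def
    scan_time_def find_time_def
  by (intro poly_bounded_intros)

lemma poly_bounded_reduce_time: "poly_bounded reduce_time"
  unfolding reduce_time_def[abs_def] num_kept_time_def select_all_time_def select_time_def
    kept_time_def few_time_def sig_equal_time_def sig_time_def up_time_def
  by (intro poly_bounded_intros)

lemma length_le_nodes: "length xs \<le> nodes (enc_list f xs)"
  by (induction xs) auto

lemma size_le_nodes:
  "num_agents G \<le> nodes (encode G)" "num_items G \<le> nodes (encode G)"
  "num_layers G \<le> nodes (encode G)" "2 \<le> nodes (encode G)"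
  using length_le_nodes[of "profiles G" enc_layer]
  by (simp_all add: encode_def num_layers_def)

lemma length_distinct_le:
  assumes "distinct L" "set L \<subseteq> {..<m}"
  shows "length L \<le> m"
  using card_mono[OF _ assms(2)] distinct_card[OF assms(1)] by simp

lemma ok_layers_instance:
  assumes "goa_instance G" "num_agents G \<le> N" "num_items G \<le> N" "num_layers G \<le> N"
  shows "ok_layers N (num_agents G) (profiles G)"
proof -
  have "ok_list N L" if "P \<in> set (profiles G)" "L \<in> set P" for P L
  proof -
    have "distinct L" "set L \<subseteq> {..<num_items G}"
      using assms(1) that by (auto simp: goa_instance_def)
    then show ?thesis
      using length_distinct_le[of L "num_items G"] assms(3) by (auto simp: ok_list_def)
  qed
  then show ?thesis
    using assms by (auto simp: ok_layers_def num_layers_def goa_instance_def)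
qed

lemma num_agents_reduce_le_self: "num_agents (reduce G) \<le> num_agents G"
  unfolding num_agents_reduce kept_agents_def
  by (rule order_trans[OF length_filter_le]) simp

lemma runs_progI: "ev (prog e) [x] e v T \<Longrightarrow> \<exists>t. runs (prog e) x v t \<and> t \<le> T"
  by (auto simp: ev_def runs_def prog_def)

text \<open>The only constant of the language is \<open>Atom\<close>, so a fixed output is assembled
  cell by cell.\<close>

fun quoteE :: "sexp \<Rightarrow> expr" where
  "quoteE Atom = AtomE"
| "quoteE (Pair u v) = PairE (quoteE u) (quoteE v)"

lemma ev_quoteE: "ev P \<rho> (quoteE v) v (nodes v)"
proof (induction v)
  case Atom
  show ?case using ev_Atom by simp
next
  case (Pair u v)
  then show ?case using ev_Pair[OF Pair] by simp
qed

text \<open>On unary numbers, repeated \<open>RightE\<close> is truncated subtraction. With 11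
  repetitions it tests whether there are at least 12 items.\<close>

lemma ev_RightE_power:
  "ev P \<rho> e (enc_nat k) T \<Longrightarrow> ev P \<rho> ((RightE ^^ i) e) (enc_nat (k - i)) (T + i)"
proof (induction i)
  case (Suc i)
  have "right (enc_nat (k - i)) = enc_nat (k - Suc i)"
    by (cases "k - i") (auto simp: Suc_diff_Suc[symmetric] diff_Suc)
  from ev_Right[OF Suc.IH[OF Suc.prems] this] show ?case by simp
qed simp

section \<open>The kernelization\<close>

definition yes_instance :: goa where
  "yes_instance = \<lparr>num_agents = 0, num_items = 0, profiles = [[]], threshold = 1\<rparr>"

text \<open>Optimality in the first layer forces the agent to take the item, legality in the second
  forbids it, and the threshold demands both layers.\<close>

definition no_instance :: goa where
  "no_instance = \<lparr>num_agents = 1, num_items = 1, profiles = [[[0]], [[]]], threshold = 2\<rparr>"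

lemma yes_instance:
  "goa_instance yes_instance" "has_globally_optimal_assignment yes_instance"
proof -
  show inst: "goa_instance yes_instance"
    by (simp add: goa_instance_def yes_instance_def num_layers_def)
  show "has_globally_optimal_assignment yes_instance"
    unfolding solve_iff[OF inst, symmetric]
    by (simp add: solve_def yes_instance_def po_list_def improves_def)
qed

lemma no_instance:
  "goa_instance no_instance" "\<not> has_globally_optimal_assignment no_instance"
proof -
  show inst: "goa_instance no_instance"
    by (simp add: goa_instance_def no_instance_def num_layers_def)
  show "\<not> has_globally_optimal_assignment no_instance"
    unfolding solve_iff[OF inst, symmetric]
    by (auto simp: solve_def no_instance_def po_list_def improves_def le_Suc_eq)
qed

definition kernelE :: expr where
  "kernelE = IfE ((RightE ^^ 11) (mE X0)) (Call reduce_fn [X0])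
     (IfE (Call solve_fn [X0]) (quoteE (encode yes_instance)) (quoteE (encode no_instance)))"

definition kernel :: "goa \<Rightarrow> goa" where
  "kernel G = (if 12 \<le> num_items G then reduce G
     else if solve G then yes_instance else no_instance)"

text \<open>The exponent 24 is \<open>2 * m + 2\<close> for m = 11, the largest number of items left
  to the search.\<close>

definition kernel_time :: "nat \<Rightarrow> nat" where
  "kernel_time N = reduce_time N + solve_factor N * (N + 2) ^ 24 +
     nodes (encode yes_instance) + nodes (encode no_instance) + 40"

lemma ev_kernelE:
  assumes G: "goa_instance G"
  shows "ev (prog kernelE) [encode G] kernelE (encode (kernel G)) (kernel_time (nodes (encode G)))"
proof -
  define N where "N = nodes (encode G)"
  have ok: "ok_layers N (num_agents G) (profiles G)" and m: "num_items G \<le> N"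
    and n: "num_agents G \<le> N"
    using size_le_nodes[of G] G by (auto simp: N_def intro!: ok_layers_instance)
  \<comment> \<open>Three steps fetch the number of items, and eleven subtract.\<close>
  have test: "ev (prog kernelE) [encode G] ((RightE ^^ 11) (mE X0)) (enc_nat (num_items G - 11)) 14"
    by (rule ev_mono[OF ev_RightE_power[of _ _ _ "num_items G" 3]])
      (rule ev_mono, (rule ev_intros | simp)+)
  have atom: "enc_nat k = Atom \<longleftrightarrow> k = 0" for k by (cases k) auto
  show ?thesis
  proof (cases "12 \<le> num_items G")
    case True
    then have "\<not> num_items G \<le> 11" by simp
    with True show ?thesis
      unfolding N_def[symmetric]
      by - (subst (2) kernelE_def, rule ev_mono,
        ((rule ev_If[OF test] ev_intros call_reduce[OF ok m] | simp only: atom | simp)+)[1],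
        simp add: kernel_def, simp add: kernel_time_def)
  next
    case False
    have "(num_agents G + 2) ^ (2 * num_items G + 2) \<le> (N + 2) ^ (2 * num_items G + 2)"
      using n by (intro power_mono) auto
    also have "\<dots> \<le> (N + 2) ^ 24" using False by (intro power_increasing) auto
    finally have "solve_time N (num_agents G) (num_items G) \<le> solve_factor N * (N + 2) ^ 24"
      by (intro order_trans[OF solve_time_le] mult_le_mono2)
    note solve = fn_ev_mono[OF call_solve[OF ok m] refl this]
    show ?thesis
    proof (cases "solve G")
      case True
      with False show ?thesis
        unfolding N_def[symmetric]
        by - (subst (2) kernelE_def, rule ev_mono,
          ((rule ev_If[OF test] ev_quoteE ev_intros solve | simp only: atom | simp)+)[1],
          simp add: kernel_def, simp add: kernel_time_def)
    next
      case no: False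
      with False show ?thesis
        unfolding N_def[symmetric]
        by - (subst (2) kernelE_def, rule ev_mono,
          ((rule ev_If[OF test] ev_quoteE ev_intros solve | simp only: atom | simp)+)[1],
          simp add: kernel_def, simp add: kernel_time_def)
    qed
  qed
qed

lemma poly_bounded_kernel_time: "poly_bounded kernel_time"
  unfolding kernel_time_def[abs_def]
  by (intro poly_bounded_intros poly_bounded_reduce_time poly_bounded_solve_factor)

lemma instance_kernel: "goa_instance G \<Longrightarrow> goa_instance (kernel G)"
  by (simp add: kernel_def instance_reduce yes_instance no_instance)

lemma kernel_iff:
  "goa_instance G \<Longrightarrow>
    has_globally_optimal_assignment (kernel G) \<longleftrightarrow> has_globally_optimal_assignment G"
  by (simp add: kernel_def reduce_iff solve_iff yes_instance no_instance)

text \<open>From \<open>m\<close> to m + 1 the left side grows by a factor of at most 4, the right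
  side by m + 1.\<close>

lemma power4_le_fact: "12 \<le> m \<Longrightarrow> (m + 1) ^ 4 \<le> fact m"
proof (induction m rule: dec_induct)
  case base
  show ?case by (simp add: fact_numeral)
next
  case (step m)
  have "12 * 12 \<le> m * m" using step.hyps(1) by (intro mult_le_mono)
  then have "(m + 2) ^ 2 \<le> 2 * (m + 1) ^ 2" by (simp add: power2_eq_square)
  then have "((m + 2) ^ 2) ^ 2 \<le> (2 * (m + 1) ^ 2) ^ 2" by (rule power_mono) simp
  then have "(m + 2) ^ 4 \<le> 4 * (m + 1) ^ 4"
    by (simp add: power_mult[symmetric] power_mult_distrib)
  also have "\<dots> \<le> (m + 1) * fact m" using step by (intro mult_le_mono) auto
  finally show ?case by simp
qed

text \<open>The square comes from lists with up to m entries, each written in unary.\<close>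

lemma nodes_encode_le:
  assumes G: "goa_instance G"
  shows "nodes (encode G) \<le> 20 * (num_layers G * ((num_agents G + 1) * (num_items G + 1) ^ 2))"
proof -
  define l n m where lnm: "l = num_layers G" "n = num_agents G" "m = num_items G"
  have l: "1 \<le> l" "threshold G \<le> l" using G by (auto simp: goa_instance_def lnm)
  have L: "nodes (enc_nats L) \<le> 1 + m * (2 * m + 2)" if "distinct L" "set L \<subseteq> {..<m}" for L
    using length_distinct_le[OF that] that(2) by (intro ok_list_nodes_le) (auto simp: ok_list_def)
  have "\<forall>P\<in>set (profiles G). nodes (enc_layer P) \<le> 1 + n * (1 + m * (2 * m + 2) + 1)"
  proof
    fix P assume P: "P \<in> set (profiles G)"
    then have "\<forall>L\<in>set P. nodes (enc_nats L) \<le> 1 + m * (2 * m + 2)"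
      using G L by (auto simp: goa_instance_def lnm)
    from nodes_enc_list_le[OF this] P G
    show "nodes (enc_layer P) \<le> 1 + n * (1 + m * (2 * m + 2) + 1)"
      by (simp add: goa_instance_def lnm)
  qed
  from nodes_enc_list_le[OF this]
  have "nodes (enc_layers (profiles G)) \<le> 1 + l * (1 + n * (1 + m * (2 * m + 2) + 1) + 1)"
    by (simp add: lnm num_layers_def)
  then have "nodes (encode G) \<le> 7 + 2 * n + 2 * m + 2 * l + l * (2 + n * (2 + m * (2 * m + 2)))"
    using l by (simp add: encode_def lnm)
  also have "\<dots> \<le> 20 * (l * ((n + 1) * (m + 1) ^ 2))"
  proof -
    define Y where "Y = l * ((n + 1) * (m + 1) ^ 2)"
    have mono: "a * (b * c) \<le> Y" if "a \<le> l" "b \<le> n + 1" "c \<le> (m + 1) ^ 2" for a b c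
      unfolding Y_def using that by (intro mult_le_mono)
    have sq: "1 \<le> (m + 1) ^ 2" "m \<le> (m + 1) ^ 2" "1 + m * (m + 1) \<le> (m + 1) ^ 2"
      by (simp_all add: power2_eq_square)
    have eq: "l * (2 + n * (2 + m * (2 * m + 2))) = 2 * l + 2 * (l * (n * (1 + m * (m + 1))))"
      by (simp add: algebra_simps)
    have "1 * (1 * 1) \<le> Y" "1 * (n * 1) \<le> Y" "1 * (1 * m) \<le> Y" "l * (1 * 1) \<le> Y"
      "l * (n * (1 + m * (m + 1))) \<le> Y"
      by (rule mono; use l sq in simp)+
    \<comment> \<open>The coefficients of the summands, each of which is at most \<open>Y\<close>,
      add up to 17.\<close>
    then show ?thesis unfolding Y_def[symmetric] eq by linarith
  qed
  finally show ?thesis by (simp add: lnm)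
qed

text \<open>The additional factorial in the exponent \<open>l + 1\<close> absorbs the fourth power
  of m + 1, of which two factors come from the number of agents and two from the encoding of a
  list.\<close>

lemma nodes_encode_reduce_le:
  assumes G: "goa_instance G" and m12: "12 \<le> num_items G"
  shows "nodes (encode (reduce G)) \<le> 20 * fact (num_items G) ^ (num_layers G + 1)"
proof -
  define l m where lm: "l = num_layers G" "m = num_items G"
  define B :: nat where "B = 6 * fact (m - 1)"
  have B: "1 \<le> B" by (simp add: B_def Suc_leI)
  have "num_agents (reduce G) + 1 \<le> m * (B ^ l * (m + 1)) + B ^ l"
    using num_agents_reduce_le[OF G] B by (intro add_mono) (simp_all add: lm B_def)
  also have "\<dots> \<le> B ^ l * (m + 1) ^ 2" by (simp add: power2_eq_square algebra_simps)
  finally have n: "num_agents (reduce G) + 1 \<le> B ^ l * (m + 1) ^ 2" .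
  have "2 * B \<le> fact m"
    using m12 fact_reduce[of m, where 'a = nat] by (simp add: B_def lm)
  then have *: "(2 * B) ^ l \<le> fact m ^ l" by (rule power_mono) simp
  have "nodes (encode (reduce G)) \<le> 20 * (l * ((num_agents (reduce G) + 1) * (m + 1) ^ 2))"
    using nodes_encode_le[OF instance_reduce[OF G]] by (simp add: lm)
  also have "\<dots> \<le> 20 * (2 ^ l * ((B ^ l * (m + 1) ^ 2) * (m + 1) ^ 2))"
    using n less_exp[of l] by (intro mult_le_mono) auto
  also have "\<dots> = 20 * ((2 * B) ^ l * (m + 1) ^ 4)"
  proof -
    have "(m + 1) ^ 2 * (m + 1) ^ 2 = (m + 1) ^ 4" by (simp flip: power_add)
    then show ?thesis by (simp only: power_mult_distrib mult.assoc)
  qed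
  also have "\<dots> \<le> 20 * (fact m ^ l * fact m)"
    using * power4_le_fact[of m] m12 by (intro mult_le_mono) (simp_all add: lm)
  finally show ?thesis by (simp add: lm mult.commute)
qed

lemma nodes_encode_kernel_le:
  assumes G: "goa_instance G"
  shows "nodes (encode (kernel G)) \<le>
    (20 + nodes (encode yes_instance) + nodes (encode no_instance)) *
      fact (num_items G) ^ (num_layers G + 1)"
proof (cases "12 \<le> num_items G")
  case True
  have "nodes (encode (kernel G)) \<le> 20 * fact (num_items G) ^ (num_layers G + 1)"
    using nodes_encode_reduce_le[OF G True] True by (simp add: kernel_def)
  then show ?thesis by (rule order_trans) (intro mult_right_mono, simp_all)
next
  case False
  have "1 \<le> (fact (num_items G) ^ (num_layers G + 1) :: nat)" by (simp add: Suc_leI)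
  moreover have "nodes (encode (kernel G)) \<le>
    20 + nodes (encode yes_instance) + nodes (encode no_instance)"
    using False by (simp add: kernel_def)
  ultimately show ?thesis
    by (metis mult_le_mono nat_mult_1_right)
qed

theorem goa_admits_kernel:
  "admits_kernel_of_size goa_instance encode has_globally_optimal_assignment
     (\<lambda>G. fact (num_items G) ^ (num_layers G + 1))"
proof -
  obtain c where c: "\<And>N. 1 \<le> N \<Longrightarrow> kernel_time N \<le> c * N ^ c"
    using poly_bounded_kernel_time by (auto simp: poly_bounded_def)
  show ?thesis
    unfolding admits_kernel_of_size_def
  proof (rule exI[of _ "prog kernelE"], rule exI[of _ c],
      rule exI[of _ "20 + nodes (encode yes_instance) + nodes (encode no_instance)"], intro allI impI)
    fix G assume G: "goa_instance G"
    obtain t where "runs (prog kernelE) (encode G) (encode (kernel G)) t"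
      "t \<le> kernel_time (nodes (encode G))"
      using runs_progI[OF ev_kernelE[OF G]] by blast
    moreover have "kernel_time (nodes (encode G)) \<le> c * nodes (encode G) ^ c"
      using size_le_nodes(4)[of G] by (intro c) simp
    ultimately show "\<exists>y t. runs (prog kernelE) (encode G) (encode y) t \<and>
      t \<le> c * nodes (encode G) ^ c \<and> goa_instance y \<and>
      (has_globally_optimal_assignment y \<longleftrightarrow> has_globally_optimal_assignment G) \<and>
      nodes (encode y) \<le> (20 + nodes (encode yes_instance) + nodes (encode no_instance)) *
        fact (num_items G) ^ (num_layers G + 1)"
      using instance_kernel[OF G] kernel_iff[OF G] nodes_encode_kernel_le[OF G]
      by (meson order_trans)
  qed
qed

section \<open>A computable bound for the parameter-dependent factor\<close>

definition tower :: "nat \<Rightarrow> nat" where "tower k = 2 ^ 2 ^ 2 ^ (k + 3)"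

definition double_fn :: nat where "double_fn = 2"
definition power2_fn :: nat where "power2_fn = 1"

text \<open>In unary, powers of two arise from repeated doubling, and doubling puts two cells in
  place of one. The main function adds three cells before it exponentiates three times.\<close>

definition tower_prog :: program where
  "tower_prog =
    [Call power2_fn [Call power2_fn [Call power2_fn [PairE AtomE (PairE AtomE (PairE AtomE X0))]]],
     IfE X0 (Call double_fn [Call power2_fn [RightE X0]]) ttE,
     IfE X0 (PairE AtomE (PairE AtomE (Call double_fn [RightE X0]))) AtomE]"

lemma fn_double:
  "ev tower_prog vs (IfE X0 (PairE AtomE (PairE AtomE (Call double_fn [RightE X0]))) AtomE) v T \<Longrightarrow>
    fn_ev tower_prog double_fn vs v T"
  by (simp add: fn_ev_def tower_prog_def double_fn_def)

lemma fn_power2: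
  "ev tower_prog vs (IfE X0 (Call double_fn [Call power2_fn [RightE X0]]) ttE) v T \<Longrightarrow>
    fn_ev tower_prog power2_fn vs v T"
  by (simp add: fn_ev_def tower_prog_def power2_fn_def)

text \<open>Computability asks for termination without a time bound, so the bound stays
  existential.\<close>

lemma tower_prog_double: "\<exists>T. fn_ev tower_prog double_fn [enc_nat k] (enc_nat (2 * k)) T"
proof (induction k)
  case 0
  show ?case
    by (rule exI, rule fn_double, rule ev_mono, ((rule ev_intros | simp)+)[1], simp, rule order_refl)
next
  case (Suc k)
  then obtain T where IH: "fn_ev tower_prog double_fn [enc_nat k] (enc_nat (2 * k)) T" by blast
  show ?case
    by (rule exI, rule fn_double, rule ev_mono, ((rule ev_intros IH | simp)+)[1], simp, rule order_refl)
qed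

lemma tower_prog_power2: "\<exists>T. fn_ev tower_prog power2_fn [enc_nat k] (enc_nat (2 ^ k)) T"
proof (induction k)
  case 0
  show ?case
    by (rule exI, rule fn_power2, rule ev_mono, ((rule ev_intros | simp)+)[1], simp, rule order_refl)
next
  case (Suc k)
  then obtain T where IH: "fn_ev tower_prog power2_fn [enc_nat k] (enc_nat (2 ^ k)) T" by blast
  obtain T' where dbl: "fn_ev tower_prog double_fn [enc_nat (2 ^ k)] (enc_nat (2 * 2 ^ k)) T'"
    using tower_prog_double by blast
  show ?case
    by (rule exI, rule fn_power2, rule ev_mono, ((rule ev_intros IH dbl | simp)+)[1], simp, rule order_refl)
qed

lemma computable_tower: "computable tower"
  unfolding computable_def
proof (rule exI, rule allI)
  fix k
  \<comment> \<open>The three successors are the cells added by the main function.\<close>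
  obtain T1 where 1: "fn_ev tower_prog power2_fn [enc_nat (Suc (Suc (Suc k)))]
      (enc_nat (2 ^ (k + 3))) T1"
    using tower_prog_power2[of "Suc (Suc (Suc k))"] by (auto simp: numeral_3_eq_3)
  obtain T2 where 2: "fn_ev tower_prog power2_fn [enc_nat (2 ^ (k + 3))] (enc_nat (2 ^ 2 ^ (k + 3))) T2"
    using tower_prog_power2 by blast
  obtain T3 where 3: "fn_ev tower_prog power2_fn [enc_nat (2 ^ 2 ^ (k + 3))] (enc_nat (tower k)) T3"
    using tower_prog_power2 unfolding tower_def by blast
  have "ev tower_prog [enc_nat k] (tower_prog ! 0) (enc_nat (tower k))
    (1 + (1 + (1 + (1 + 1 + (1 + 1 + (1 + 1 + 1)) + 0) + T1 + 0) + T2 + 0) + T3)"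
    by (simp only: tower_prog_def nth_Cons_0, fold tower_prog_def)
      (intro ev_Call[OF _ 3] ev_Call[OF _ 2] ev_Call[OF _ 1[simplified]] ev_intros)
  then show "\<exists>t. runs tower_prog (enc_nat k) (enc_nat (tower k)) t"
    by (auto simp: ev_def runs_def tower_prog_def)
qed

lemma fact_le_2_power: "fact k \<le> (2::nat) ^ (k * k)"
proof -
  have "fact k \<le> (k::nat) ^ k" using fact_le_power[of k, where 'a = nat] by simp
  also have "\<dots> \<le> (2 ^ k) ^ k" by (intro power_mono) (simp_all add: less_imp_le)
  finally show ?thesis by (simp add: power_mult)
qed

text \<open>The left side is the exponential factor of \<open>solve_time_le\<close> for the reduced
  instance. With k = m + l, the number of agents is 2 to a cubic polynomial in k, raising it to the
  power makes the exponent quartic, and \<open>k + 1 \<le> 2 ^ k\<close> bounds that by a power of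
  two with exponent 4 k + 4.\<close>

lemma num_agents_reduce_tower:
  assumes G: "goa_instance G"
  shows "(num_agents (reduce G) + 2) ^ (2 * num_items G + 2) \<le>
    tower (num_items G + num_layers G)"
proof -
  define l m k where lmk: "l = num_layers G" "m = num_items G" "k = m + l"
  have k2: "k + 1 \<le> 2 ^ k" using less_exp[of k] by linarith
  have "6 * fact (m - 1) \<le> (2::nat) ^ 3 * 2 ^ (k * k)"
  proof (intro mult_le_mono)
    have "fact (m - 1) \<le> (fact k :: nat)" by (rule fact_mono) (simp add: lmk)
    then show "fact (m - 1) \<le> (2::nat) ^ (k * k)" using fact_le_2_power by (rule order_trans)
  qed simp
  then have B: "6 * fact (m - 1) \<le> (2::nat) ^ (3 + k * k)" by (simp only: power_add)
  have "(6 * fact (m - 1)) ^ l \<le> ((2::nat) ^ (3 + k * k)) ^ l" using B by (rule power_mono) simp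
  also have "\<dots> \<le> (2 ^ (3 + k * k)) ^ k" by (rule power_increasing) (simp_all add: lmk)
  finally have Bl: "(6 * fact (m - 1)) ^ l \<le> (2::nat) ^ ((3 + k * k) * k)" by (simp add: power_mult)
  have "num_agents (reduce G) \<le> m * ((6 * fact (m - 1)) ^ l * (m + 1))"
    using num_agents_reduce_le[OF G] by (simp add: lmk)
  also have "\<dots> \<le> 2 ^ k * (2 ^ ((3 + k * k) * k) * 2 ^ k)"
    using k2 Bl by (intro mult_le_mono) (auto simp: lmk)
  also have "\<dots> = 2 ^ (k + ((3 + k * k) * k + k))" by (simp only: power_add)
  finally have "num_agents (reduce G) + 2 \<le> 2 ^ (k + ((3 + k * k) * k + k)) * 1 + 2"
    by simp
  also have "\<dots> \<le> 2 ^ (k + ((3 + k * k) * k + k)) * 4"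
  proof -
    have "1 \<le> (2::nat) ^ (k + ((3 + k * k) * k + k))" by simp
    then show ?thesis by linarith
  qed
  also have "\<dots> = 2 ^ (k + ((3 + k * k) * k + k) + 2)" by simp
  also have "\<dots> \<le> 2 ^ (8 * (k + 1) ^ 3)"
    by (rule power_increasing) (simp_all add: power3_eq_cube algebra_simps)
  finally have "(num_agents (reduce G) + 2) ^ (2 * m + 2) \<le> (2 ^ (8 * (k + 1) ^ 3)) ^ (2 * m + 2)"
    by (rule power_mono) simp
  also have "\<dots> \<le> (2 ^ (8 * (k + 1) ^ 3)) ^ (2 * (k + 1))"
    by (rule power_increasing) (simp_all add: lmk)
  also have "\<dots> = 2 ^ (8 * (k + 1) ^ 3 * (2 * (k + 1)))" by (simp only: power_mult)
  also have "8 * (k + 1) ^ 3 * (2 * (k + 1)) = 16 * (k + 1) ^ 4"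
    by (simp only: power3_eq_cube power4_eq_xxxx)
  also have "(2::nat) ^ (16 * (k + 1) ^ 4) \<le> 2 ^ (2 ^ 4 * (2 ^ k) ^ 4)"
    using k2 by (intro power_increasing mult_le_mono power_mono) auto
  also have "\<dots> = 2 ^ 2 ^ (4 + k * 4)" by (simp only: power_add power_mult)
  also have "\<dots> \<le> tower k"
    unfolding tower_def using k2
    by (intro power_increasing) (simp_all add: power_add)
  finally show ?thesis by (simp add: lmk)
qed

definition fptE :: expr where "fptE = Call solve_fn [Call reduce_fn [X0]]"

theorem goa_fixed_parameter_tractable:
  "fixed_parameter_tractable goa_instance encode has_globally_optimal_assignment
     (\<lambda>G. num_items G + num_layers G)"
proof -
  have "poly_bounded (\<lambda>N. reduce_time N + solve_factor N + 10)"
    by (intro poly_bounded_intros poly_bounded_reduce_time poly_bounded_solve_factor)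
  then obtain c where c: "\<And>N. 1 \<le> N \<Longrightarrow> reduce_time N + solve_factor N + 10 \<le> c * N ^ c"
    by (auto simp: poly_bounded_def)
  show ?thesis
    unfolding fixed_parameter_tractable_def
  proof (rule exI[of _ "prog fptE"], rule exI[of _ tower], rule exI[of _ "c + c"],
      intro conjI allI impI)
    show "computable tower" by (rule computable_tower)
    fix G assume G: "goa_instance G"
    define N where "N = nodes (encode G)"
    let ?R = "reduce G" and ?k = "num_items G + num_layers G"
    have N: "num_agents G \<le> N" "num_items G \<le> N" "num_layers G \<le> N" "2 \<le> N"
      using size_le_nodes[of G] by (simp_all add: N_def)
    have okG: "ok_layers N (num_agents G) (profiles G)"
      using ok_layers_instance[OF G] N by simp
    \<comment> \<open>The bound \<open>N\<close> taken from the input also covers the reduced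
      instance, which has no more agents and the same numbers of items and layers.\<close>
    have okR: "ok_layers N (num_agents ?R) (profiles ?R)"
      using ok_layers_instance[OF instance_reduce[OF G]] N num_agents_reduce_le_self[of G] by simp
    have mR: "num_items ?R \<le> N" using N by simp
    define W where "W = tower ?k"
    have W: "1 \<le> W" by (simp add: W_def tower_def)
    have "solve_time N (num_agents ?R) (num_items ?R) \<le> solve_factor N * W"
      using num_agents_reduce_tower[OF G]
      by (intro order_trans[OF solve_time_le] mult_le_mono2) (simp add: W_def)
    then have "reduce_time N + solve_time N (num_agents ?R) (num_items ?R) + 10 \<le>
        reduce_time N * W + solve_factor N * W + 10 * W"
      using W by (intro add_mono) auto
    also have "\<dots> = (reduce_time N + solve_factor N + 10) * W" by (simp only: distrib_right)
    \<comment> \<open>The definition of fixed-parameter tractability provides no constant factor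
      beside \<open>f\<close>, so \<open>c\<close> is absorbed by a second power, using
      \<open>c \<le> 2 ^ c\<close> and \<open>N \<ge> 2\<close>.\<close>
    also have "\<dots> \<le> (N ^ c * N ^ c) * W"
    proof (rule mult_le_mono1)
      have "c \<le> N ^ c" using less_exp[of c] power_mono[OF N(4), of c] by linarith
      then have "c * N ^ c \<le> N ^ c * N ^ c" by (rule mult_le_mono1)
      with c[of N] N(4) show "reduce_time N + solve_factor N + 10 \<le> N ^ c * N ^ c" by linarith
    qed
    also have "\<dots> = W * N ^ (c + c)" by (simp add: power_add)
    finally have T: "reduce_time N + solve_time N (num_agents ?R) (num_items ?R) + 10 \<le> W * N ^ (c + c)" .
    have "ev (prog fptE) [encode G] fptE (sbool (solve ?R))
      (reduce_time N + solve_time N (num_agents ?R) (num_items ?R) + 10)"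
      by (subst (2) fptE_def, rule ev_mono,
          ((rule ev_intros call_reduce[OF okG N(2)] call_solve[OF okR mR])+)[1], simp_all)
    from runs_progI[OF this] obtain t where t: "runs (prog fptE) (encode G) (sbool (solve ?R)) t"
      "t \<le> reduce_time N + solve_time N (num_agents ?R) (num_items ?R) + 10" by blast
    show "\<exists>v t. runs (prog fptE) (encode G) v t \<and>
      (v \<noteq> Atom \<longleftrightarrow> has_globally_optimal_assignment G) \<and>
      t \<le> tower ?k * nodes (encode G) ^ (c + c)"
    proof (intro exI conjI)
      show "runs (prog fptE) (encode G) (sbool (solve ?R)) t" by (rule t(1))
      show "sbool (solve ?R) \<noteq> Atom \<longleftrightarrow> has_globally_optimal_assignment G"
        using solve_iff[OF instance_reduce[OF G]] reduce_iff[OF G] by simp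
      show "t \<le> tower ?k * nodes (encode G) ^ (c + c)"
        using order_trans[OF t(2) T] unfolding N_def W_def .
    qed
  qed
qed

theorem theorem3:
  "admits_kernel_of_size goa_instance encode has_globally_optimal_assignment
     (\<lambda>G. fact (num_items G) ^ (num_layers G + 1)) \<and>
   fixed_parameter_tractable goa_instance encode has_globally_optimal_assignment
     (\<lambda>G. num_items G + num_layers G)"
  using goa_admits_kernel goa_fixed_parameter_tractable by (rule conjI)

end
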